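(* Let $\mathbb{P}$ be the set of prime numbers. Then $D^k(\mathbb{P})$ is dense in $S^{k-1}$, for every integer $k \geq 2$.
   Context: $\|\cdot\|$ denotes the Euclidean norm. For every integer $k \geq 2$, put $S^{k-1} := \{\boldsymbol{x} \in [0,1]^k : \|\boldsymbol{x}\| = 1\}$ (the part of the unit sphere of $\mathbb{R}^k$ with nonnegative coordinates), with the subspace topology from $\mathbb{R}^k$, and for a set $A$ of positive integers put $D^k(A) := \{\boldsymbol{a}/\|\boldsymbol{a}\| : \boldsymbol{a} \in A^k\} \subseteq S^{k-1}$. *)

theory Defs
  imports "HOL-Analysis.Analysis" "HOL-Computational_Algebra.Primes"
begin

text \<open>
  The dimension \<open>k\<close> is the cardinality of the finite index type \<^typ>\<open>'k\<close>, and
  \<^term>\<open>norm\<close> on \<^typ>\<open>real ^ 'k\<close> is the Euclidean norm.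
\<close>

definition nonneg_sphere :: "(real ^ 'k) set" where
  "nonneg_sphere = {x. (\<forall>i. x $ i \<in> {0..1}) \<and> norm x = 1}"

definition real_vec :: "nat ^ 'k \<Rightarrow> real ^ 'k" where
  "real_vec a = (\<chi> i. real (a $ i))"

text \<open>
  Intended for sets \<open>A\<close> of positive integers only; then no \<open>a\<close> below is the zero vector.
\<close>

definition direction_set :: "nat set \<Rightarrow> (real ^ 'k) set" where
  "direction_set A = {real_vec a /\<^sub>R norm (real_vec a) | a. \<forall>i. a $ i \<in> A}"

lemma direction_set_subset_nonneg_sphere:
  assumes "\<And>n. n \<in> A \<Longrightarrow> 0 < n"
  shows "(direction_set A :: (real ^ 'k) set) \<subseteq> nonneg_sphere"
proof
  fix x :: "real ^ 'k"
  assume "x \<in> direction_set A"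
  then obtain a :: "nat ^ 'k" where x: "x = real_vec a /\<^sub>R norm (real_vec a)"
    and a: "\<And>i. a $ i \<in> A"
    unfolding direction_set_def by blast
  have "real_vec a \<noteq> 0"
    using assms[OF a] by (auto simp: real_vec_def vec_eq_iff)
  then have 1: "norm x = 1"
    by (simp add: x)
  have "0 \<le> x $ i" for i
    by (simp add: x real_vec_def)
  moreover have "x $ i \<le> 1" for i
    using component_le_norm_cart[of x i] 1 by linarith
  ultimately show "x \<in> nonneg_sphere"
    using 1 by (simp add: nonneg_sphere_def)
qed

definition dense_in :: "'a topology \<Rightarrow> 'a set \<Rightarrow> bool" where
  "dense_in X D \<longleftrightarrow> D \<subseteq> topspace X \<and> X closure_of D = topspace X"

end

theory Submission
  imports Defs "HOL-Complex_Analysis.Complex_Analysis" "HOL-Real_Asymp.Real_Asymp"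
    "HOL-Number_Theory.Prime_Powers"
begin

text \<open>
  Density needs primes \<open>p\<^sub>i\<close> with \<open>p\<^sub>i / T\<close> close to prescribed nonnegative reals for a common \<open>T\<close>, so it suffices
  that for every \<open>k\<close> the interval \<open>(k\<^sup>2 j, (k + 1)\<^sup>2 j]\<close> contains a prime once \<open>j\<close> is large. Following
  Newman and Zagier, \<open>\<zeta>\<close> has no zeros on \<open>Re s \<ge> 1\<close>, and a contour-integral Tauberian theorem then shows
  that \<open>\<integral> (\<psi>(x) - x) / x\<^sup>2 dx\<close> converges. If \<open>(k\<^sup>2 j, (k + 1)\<^sup>2 j]\<close> contained no prime, \<open>\<psi>\<close> would be almost
  constant there; the integrals of \<open>\<psi>(x) / x\<^sup>2\<close> over the two halves cut at \<open>k (k + 1) j\<close> would then have ratio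
  about \<open>k / (k + 1)\<close>, whereas those of \<open>1 / x\<close> are equal.
\<close>

section \<open>Newman's Tauberian theorem\<close>

lemma Cauchy_integral_right_arc_closed:
  fixes F :: "complex \<Rightarrow> complex"
  assumes S: "convex S" "open S" "0 \<in> S" and F: "F holomorphic_on S" and R: "R > 0"
    and arc: "path_image (part_circlepath 0 R (-pi/2) (pi/2)) \<subseteq> S"
    and p: "valid_path p" "pathstart p = \<i> * R" "pathfinish p = - (\<i> * R)" "path_image p \<subseteq> S"
    and slit: "\<And>w. w \<in> path_image p \<Longrightarrow> - w \<notin> \<real>\<^sub>\<le>\<^sub>0"
  shows "contour_integral (part_circlepath 0 R (-pi/2) (pi/2)) (\<lambda>w. F w / w)
       + contour_integral p (\<lambda>w. F w / w) = 2 * pi * \<i> * F 0"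
    and "(\<lambda>w. F w / w) contour_integrable_on part_circlepath 0 R (-pi/2) (pi/2)"
    and "(\<lambda>w. F w / w) contour_integrable_on p"
proof -
  let ?a = "part_circlepath 0 R (-pi/2) (pi/2)"
  have a_start: "pathstart ?a = - (\<i> * R)" and a_finish: "pathfinish ?a = \<i> * R"
    by (simp_all add: complex_eq_iff Re_exp Im_exp)
  have a_cos: "\<exists>t. -pi/2 \<le> t \<and> t \<le> pi/2 \<and> w = R * cis t" if "w \<in> path_image ?a" for w
    using that by (auto simp: path_image_part_circlepath' closed_segment_eq_real_ivl cis_conv_exp mult.commute)
  have a_slit: "w \<notin> \<real>\<^sub>\<le>\<^sub>0" if w: "w \<in> path_image ?a" for w
  proof
    assume neg: "w \<in> \<real>\<^sub>\<le>\<^sub>0"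
    obtain t where t: "-pi/2 \<le> t" "t \<le> pi/2" "w = R * cis t" using a_cos[OF w] by blast
    have "Re w \<ge> 0" using t R cos_ge_zero[of t] by simp
    with neg have "w = 0"
      by (auto simp: complex_nonpos_Reals_iff complex_eq_iff)
    then show False using t R by (simp add: cis_neq_zero)
  qed
  have va: "valid_path ?a" by simp
  have vj: "valid_path (?a +++ p)" using va p(1,2) a_finish by (simp add: valid_path_join)
  have closed: "pathfinish (?a +++ p) = pathstart (?a +++ p)" using p a_start by simp
  have not0: "0 \<notin> path_image ?a" "0 \<notin> path_image p" using a_slit slit by force+
  have img: "path_image (?a +++ p) \<subseteq> S - {0}"
    using arc p(4) not0 path_image_join[of ?a p] p(2) a_finish by auto
  have Ia: "((\<lambda>w. 1 / w) has_contour_integral (Ln (pathfinish ?a) - Ln (pathstart ?a))) ?a"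
    by (rule contour_integral_primitive[where S = "- \<real>\<^sub>\<le>\<^sub>0"])
       (use a_slit in \<open>auto intro!: derivative_eq_intros simp: field_simps\<close>)
  have Ip: "((\<lambda>w. 1 / w) has_contour_integral (Ln (- pathfinish p) - Ln (- pathstart p))) p"
    by (rule contour_integral_primitive[where S = "{w. - w \<notin> \<real>\<^sub>\<le>\<^sub>0}" and f = "\<lambda>w. Ln (- w)"])
       (use slit p in \<open>auto intro!: derivative_eq_intros simp: field_simps\<close>)
  have lnp: "Ln (\<i> * R) = ln R + \<i> * pi / 2"
    using Ln_times_of_real[of R "\<i>"] R by (simp add: mult.commute Ln_of_real)
  have lnm: "Ln (-(\<i> * R)) = ln R - \<i> * pi / 2"
    using Ln_times_of_real[of R "-\<i>"] R by (simp add: mult.commute Ln_of_real)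
  have 1: "((\<lambda>w. 1 / w) has_contour_integral (2 * pi * \<i>)) (?a +++ p)"
    using has_contour_integral_join[OF Ia Ip va p(1)] unfolding a_start a_finish p(2,3)
    by (simp add: lnp lnm algebra_simps)
  have wn: "winding_number (?a +++ p) 0 = 1"
    using winding_number_valid_path[OF vj, of 0] img contour_integral_unique[OF 1] by auto
  have int: "((\<lambda>w. F w / (w - 0)) has_contour_integral (2*pi * \<i> * winding_number (?a +++ p) 0 * F 0)) (?a +++ p)"
    by (rule Cauchy_integral_formula_convex_simple[OF S(1) F])
       (use S vj img closed in \<open>auto simp: interior_open\<close>)
  have int': "((\<lambda>w. F w / w) has_contour_integral (2*pi * \<i> * F 0)) (?a +++ p)"
    using int wn by simp
  have i1: "(\<lambda>w. F w / w) contour_integrable_on ?a" and i2: "(\<lambda>w. F w / w) contour_integrable_on p"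
    using contour_integrable_join[of ?a p "\<lambda>w. F w / w"] int' va p(1,2) a_finish
    by (auto simp: contour_integrable_on_def)
  then show "(\<lambda>w. F w / w) contour_integrable_on ?a" "(\<lambda>w. F w / w) contour_integrable_on p" by auto
  show "contour_integral ?a (\<lambda>w. F w / w) + contour_integral p (\<lambda>w. F w / w) = 2 * pi * \<i> * F 0"
    using contour_integral_join[OF i1 i2 va p(1)] contour_integral_unique[OF int'] by simp
qed

lemma right_arc_memD:
  assumes "w \<in> path_image (part_circlepath 0 R (-pi/2) (pi/2))" "R > 0"
  shows "norm w = R" "Re w \<ge> 0"
proof -
  have "\<exists>t. -pi/2 \<le> t \<and> t \<le> pi/2 \<and> w = R * cis t"
    using assms by (auto simp: path_image_part_circlepath' closed_segment_eq_real_ivl cis_conv_exp mult.commute)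
  then obtain t where t: "-pi/2 \<le> t" "t \<le> pi/2" "w = R * cis t" by blast
  then show "norm w = R" "Re w \<ge> 0" using assms(2) cos_ge_zero[of t] by (simp_all add: norm_mult)
qed

lemma left_arc_memD:
  assumes "w \<in> path_image (part_circlepath 0 R (pi/2) (3*pi/2))" "R > 0"
  shows "norm w = R" "Re w \<le> 0"
proof -
  have "\<exists>t. pi/2 \<le> t \<and> t \<le> 3*pi/2 \<and> w = R * cis t"
    using assms by (auto simp: path_image_part_circlepath' closed_segment_eq_real_ivl cis_conv_exp mult.commute)
  then obtain t where t: "pi/2 \<le> t" "t \<le> 3*pi/2" "w = R * cis t" by blast
  have "cos (t - pi) \<ge> 0" using t by (intro cos_ge_zero) auto
  then have "cos t \<le> 0" by (simp add: cos_diff)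
  with t show "norm w = R" "Re w \<le> 0" using assms(2) by (simp_all add: norm_mult mult_nonneg_nonpos)
qed

lemma norm_Newman_kernel:
  assumes "norm z = R" "R > 0"
  shows "norm ((1 + z^2 / of_real R ^ 2) / z) = 2 * \<bar>Re z\<bar> / R^2"
proof -
  have z: "z \<noteq> 0" using assms by auto
  have R2: "of_real R ^ 2 = z * cnj z" using assms(1) complex_norm_square[of z] by simp
  have "(1 + z^2 / of_real R ^ 2) / z = (z + cnj z) / of_real R ^ 2"
    using z assms(2) R2 by (simp add: field_simps power2_eq_square)
  also have "\<dots> = of_real (2 * Re z / R^2)" by (simp add: complex_add_cnj)
  finally show ?thesis by (simp add: norm_divide norm_mult norm_power)
qed

definition bracket_path :: "real \<Rightarrow> real \<Rightarrow> real \<Rightarrow> complex" where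
  "bracket_path R d = linepath (\<i> * R) (Complex (-d) R) +++
     (linepath (Complex (-d) R) (Complex (-d) (-R)) +++ linepath (Complex (-d) (-R)) (-(\<i> * R)))"

lemma bracket_path:
  shows "valid_path (bracket_path R d)" "pathstart (bracket_path R d) = \<i> * R"
    "pathfinish (bracket_path R d) = - (\<i> * R)"
  unfolding bracket_path_def by (auto intro!: valid_path_join)

lemma bracket_path_memD:
  assumes "w \<in> path_image (bracket_path R d)" "R > 0" "d > 0"
  shows "(\<bar>Im w\<bar> = R \<and> - d \<le> Re w \<and> Re w \<le> 0) \<or> (Re w = - d \<and> \<bar>Im w\<bar> \<le> R)"
proof -
  have iR: "\<i> * R = Complex 0 R" "-(\<i> * R) = Complex 0 (-R)" by (auto simp: complex_eq_iff)
  have "w \<in> closed_segment (Complex 0 R) (Complex (-d) R) \<union> closed_segment (Complex (-d) R) (Complex (-d) (-R))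
      \<union> closed_segment (Complex (-d) (-R)) (Complex 0 (-R))"
    using assms(1) unfolding bracket_path_def iR(2) unfolding iR(1) by (simp add: path_image_join)
  then show ?thesis
    using assms(2,3) by (auto simp: closed_segment_same_Re closed_segment_same_Im closed_segment_eq_real_ivl split: if_splits)
qed

lemma norm_contour_integral_bracket_path_le:
  assumes f: "f contour_integrable_on (bracket_path R d)" and "R > 0" "d > 0" "B \<ge> 0"
    and B: "\<And>w. w \<in> path_image (bracket_path R d) \<Longrightarrow> norm (f w) \<le> B"
  shows "norm (contour_integral (bracket_path R d) f) \<le> B * (2 * d + 2 * R)"
proof -
  let ?a = "linepath (\<i> * R) (Complex (-d) R)" and ?b = "linepath (Complex (-d) R) (Complex (-d) (-R))"
  let ?c = "linepath (Complex (-d) (-R)) (-(\<i> * R))"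
  have i1: "f contour_integrable_on ?a" "f contour_integrable_on (?b +++ ?c)"
    using f unfolding bracket_path_def by (auto dest: contour_integrable_joinD1 contour_integrable_joinD2 intro!: valid_path_join)
  then have i2: "f contour_integrable_on ?b" "f contour_integrable_on ?c"
    by (auto dest: contour_integrable_joinD1 contour_integrable_joinD2 intro!: valid_path_join)
  have img: "path_image (bracket_path R d) = path_image ?a \<union> (path_image ?b \<union> path_image ?c)"
    unfolding bracket_path_def by (simp add: path_image_join)
  have "norm (contour_integral ?a f) \<le> B * norm (Complex (-d) R - \<i> * R)"
    using img B by (intro contour_integral_bound_linepath i1 assms) auto
  also have "Complex (-d) R - \<i> * R = of_real (-d)" by (auto simp: complex_eq_iff)
  finally have a: "norm (contour_integral ?a f) \<le> B * d" using assms by simp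
  have "norm (contour_integral ?b f) \<le> B * norm (Complex (-d) (-R) - Complex (-d) R)"
    using img B by (intro contour_integral_bound_linepath i2 assms) auto
  also have "Complex (-d) (-R) - Complex (-d) R = \<i> * of_real (- 2 * R)" by (auto simp: complex_eq_iff)
  finally have b: "norm (contour_integral ?b f) \<le> B * (2 * R)" using assms by (simp add: norm_mult)
  have "norm (contour_integral ?c f) \<le> B * norm (-(\<i> * R) - Complex (-d) (-R))"
    using img B by (intro contour_integral_bound_linepath i2 assms) auto
  also have "-(\<i> * R) - Complex (-d) (-R) = of_real d" by (auto simp: complex_eq_iff)
  finally have c: "norm (contour_integral ?c f) \<le> B * d" using assms by simp
  have "contour_integral (bracket_path R d) f = contour_integral ?a f + (contour_integral ?b f + contour_integral ?c f)"
    unfolding bracket_path_def using i1 i2 by (auto simp: contour_integral_join intro!: valid_path_join)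
  then have "norm (contour_integral (bracket_path R d) f) \<le> B * d + (B * (2 * R) + B * d)"
    using norm_triangle_mono[OF a norm_triangle_mono[OF b c]] by simp
  then show ?thesis by (simp add: algebra_simps)
qed

lemma powr_mult_neg_le_inverse_ln:
  fixes n x :: real
  assumes "n > 1" "x \<le> 0"
  shows "n powr x * \<bar>x\<bar> \<le> 1 / ln n"
proof -
  have ln: "ln n > 0" using assms by simp
  have "\<bar>x\<bar> * ln n + 1 \<le> exp (\<bar>x\<bar> * ln n)" using exp_ge_add_one_self[of "\<bar>x\<bar> * ln n"] by linarith
  then have "\<bar>x\<bar> * ln n \<le> exp (\<bar>x\<bar> * ln n)" by linarith
  moreover have "n powr x = 1 / exp (\<bar>x\<bar> * ln n)" using assms
    by (simp add: powr_def exp_minus field_simps flip: exp_add)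
  ultimately have "n powr x * (\<bar>x\<bar> * ln n) \<le> 1" by (simp add: divide_le_eq)
  then show ?thesis using ln by (simp add: field_simps)
qed

lemma norm_of_nat_powr: "norm (of_nat n powr z :: complex) = real n powr Re z"
  using norm_powr_real_powr[of "of_nat n" z] by (simp add: Reals_of_nat)

text \<open>The hypothesis is what one gets for \<open>w n z = \<integral> f(x) x powr (- z - 1) dx\<close> over \<open>[n + 1, n + 2]\<close> when \<open>\<bar>f\<bar> \<le> B\<close>.\<close>

lemma Newman_sum_bounds:
  fixes w :: "nat \<Rightarrow> complex \<Rightarrow> complex"
  assumes bound: "\<And>n z. Re z \<noteq> 0 \<Longrightarrow>
      norm (w n z) \<le> B * (real (Suc n) powr - Re z - real (Suc (Suc n)) powr - Re z) / Re z"
    and B: "B \<ge> 0"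
  shows "Re z > 0 \<Longrightarrow> (\<lambda>n. w n z) sums s \<Longrightarrow> norm (s - (\<Sum>n<N. w n z)) \<le> B * real (Suc N) powr - Re z / Re z"
    and "Re z < 0 \<Longrightarrow> norm (\<Sum>n<N. w n z) \<le> B * real (Suc N) powr - Re z / \<bar>Re z\<bar>"
proof -
  assume z: "Re z > 0" and s: "(\<lambda>n. w n z) sums s"
  let ?b = "\<lambda>n. B * (real (Suc n) powr - Re z - real (Suc (Suc n)) powr - Re z) / Re z"
  let ?f = "\<lambda>n. B / Re z * - (real (Suc n) powr - Re z)"
  have lim: "(\<lambda>n. ?f (n + N)) \<longlonglongrightarrow> B / Re z * - 0"
    by (rule LIMSEQ_ignore_initial_segment, intro tendsto_mult_left tendsto_minus)
       (use z in real_asymp)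
  have tel: "(\<lambda>n. ?f (Suc n + N) - ?f (n + N)) sums (B / Re z * - 0 - ?f (0 + N))"
    using telescope_sums[OF lim] by simp
  have bs: "(\<lambda>n. ?b (n + N)) sums (B * real (Suc N) powr - Re z / Re z)"
    using tel z by (simp add: field_simps)
  have ws: "(\<lambda>n. w (n + N) z) sums (s - (\<Sum>n<N. w n z))"
    using s by (rule sums_split_initial_segment)
  have le: "norm (w (n + N) z) \<le> ?b (n + N)" for n using bound[of z "n+N"] z by simp
  have "norm (\<Sum>n. w (n + N) z) \<le> (\<Sum>n. ?b (n + N))"
    by (rule norm_suminf_le[OF le]) (rule sums_summable[OF bs])
  then show "norm (s - (\<Sum>n<N. w n z)) \<le> B * real (Suc N) powr - Re z / Re z"
    using bs ws by (simp add: sums_iff)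
next
  assume z: "Re z < 0"
  let ?b = "\<lambda>n. B * (real (Suc n) powr - Re z - real (Suc (Suc n)) powr - Re z) / Re z"
  let ?f = "\<lambda>n. B / \<bar>Re z\<bar> * real (Suc n) powr - Re z"
  have "norm (\<Sum>n<N. w n z) \<le> (\<Sum>n<N. ?b n)"
    using bound[of z] z by (intro sum_norm_le) auto
  also have "\<dots> = (\<Sum>n<N. ?f (Suc n) - ?f n)"
    using z by (intro sum.cong) (auto simp: field_simps)
  also have "\<dots> = ?f N - ?f 0" by (rule sum_lessThan_telescope)
  also have "\<dots> \<le> ?f N" using B by simp
  finally show "norm (\<Sum>n<N. w n z) \<le> B * real (Suc N) powr - Re z / \<bar>Re z\<bar>" by simp
qed

lemma Newman_estimate:
  fixes w :: "nat \<Rightarrow> complex \<Rightarrow> complex"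
  assumes hol: "\<And>n. w n holomorphic_on UNIV"
    and bound: "\<And>n z. Re z \<noteq> 0 \<Longrightarrow>
      norm (w n z) \<le> B * (real (Suc n) powr - Re z - real (Suc (Suc n)) powr - Re z) / Re z"
    and B: "B \<ge> 0" and U: "open U" "{z. Re z \<ge> 0} \<subseteq> U" and g: "g holomorphic_on U"
    and sums: "\<And>z. Re z > 0 \<Longrightarrow> (\<lambda>n. w n z) sums g z" and R: "R > 0"
  shows "\<exists>C. \<forall>N\<ge>1. 2 * pi * norm (g 0 - (\<Sum>n<N. w n 0)) \<le> 4 * pi * B / R + C / ln (Suc N)"
proof -
  define K where "K = cball 0 (2*R) \<inter> {z. Re z \<ge> 0}"
  have cK: "compact K" unfolding K_def
    by (intro compact_Int_closed compact_cball closed_halfspace_Re_ge)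
  have KU: "K \<subseteq> U" unfolding K_def using U by auto
  obtain e where e: "e > 0" "(\<Union>x\<in>K. ball x e) \<subseteq> U"
    using compact_subset_open_imp_ball_epsilon_subset[OF cK U(1) KU] by blast
  define S where "S = ball 0 (2*R) \<inter> {z. Re z > - e}"
  have S: "convex S" "open S" "0 \<in> S"
    unfolding S_def using R e by (auto intro!: convex_Int open_Int convex_halfspace_Re_gt open_halfspace_Re_gt)
  have SU: "S \<subseteq> U"
  proof
    fix z assume z: "z \<in> S"
    define y where "y = Complex (max 0 (Re z)) (Im z)"
    have "norm y \<le> norm z" unfolding y_def cmod_def by (auto intro!: real_sqrt_le_mono simp: max_def)
    then have "y \<in> K" using z unfolding K_def S_def by (auto simp: y_def)
    moreover have "z - y = of_real (min 0 (Re z))" by (auto simp: y_def complex_eq_iff)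
    then have "norm (z - y) < e" using z e(1) unfolding S_def by (simp only: norm_of_real) auto
    then have "dist y z < e" by (simp add: dist_norm norm_minus_commute)
    ultimately show "z \<in> U" using e(2) by (meson UN_I mem_ball subsetD)
  qed
  define d where "d = min (e/2) (R/2)"
  have d: "d > 0" "d < e" "d \<le> R/2" using e R by (auto simp: d_def)
  let ?a = "part_circlepath 0 R (-pi/2) (pi/2)" and ?l = "part_circlepath 0 R (pi/2) (3*pi/2)"
  let ?p = "bracket_path R d"
  have aS: "path_image ?a \<subseteq> S" using right_arc_memD[OF _ R] R e(1) unfolding S_def by force
  have pnorm: "norm z < 2 * R \<and> norm z \<ge> d" if z: "z \<in> path_image ?p" for z
  proof -
    have "\<bar>Re z\<bar> \<le> R / 2" "\<bar>Im z\<bar> \<le> R" and o: "\<bar>Im z\<bar> = R \<or> \<bar>Re z\<bar> = d" using bracket_path_memD[OF z R d(1)] d by auto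
    then have "norm z < 2 * R" using cmod_le[of z] R by linarith
    moreover have "norm z \<ge> d" using o d abs_Re_le_cmod[of z] abs_Im_le_cmod[of z] R by linarith
    ultimately show ?thesis by simp
  qed
  have pS: "path_image ?p \<subseteq> S"
    using pnorm bracket_path_memD[OF _ R d(1)] d unfolding S_def by fastforce
  have pslit: "- z \<notin> \<real>\<^sub>\<le>\<^sub>0" if "z \<in> path_image ?p" for z
    using bracket_path_memD[OF that R d(1)] R d(1) by (auto simp: complex_nonpos_Reals_iff)
  have lslit: "- z \<notin> \<real>\<^sub>\<le>\<^sub>0" if z: "z \<in> path_image ?l" for z
  proof
    assume "- z \<in> \<real>\<^sub>\<le>\<^sub>0"
    then have "z = 0" using left_arc_memD[OF z R] by (auto simp: complex_nonpos_Reals_iff complex_eq_iff)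
    with left_arc_memD[OF z R] R show False by simp
  qed
  have "continuous_on (path_image ?p) g"
    using g pS SU by (meson holomorphic_on_imp_continuous_on continuous_on_subset)
  then have "bounded (g ` path_image ?p)"
    by (intro compact_imp_bounded compact_continuous_image compact_valid_path_image bracket_path)
  then obtain M where M: "M > 0" "\<And>z. z \<in> path_image ?p \<Longrightarrow> norm (g z) \<le> M"
    unfolding bounded_pos by auto
  define D where "D = M / d * (4 / R + 5 / d)"
  show ?thesis
  proof (intro exI allI impI)
    fix N :: nat assume N: "N \<ge> 1"
    let ?n = "real (Suc N)"
    define W where "W z = (\<Sum>n<N. w n z)" for z
    define k where "k z = of_nat (Suc N) powr z * (1 + z^2 / of_real R ^ 2)" for z :: complex
    have "1 + complex_of_nat N \<noteq> 0" by (metis of_nat_Suc of_nat_neq_0)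
    then have k0: "k 0 = 1" by (simp add: k_def)
    have kh: "k holomorphic_on A" for A unfolding k_def
      using R by (intro holomorphic_intros) auto
    have Wh: "W holomorphic_on A" for A unfolding W_def
      by (intro holomorphic_intros holomorphic_on_subset[OF hol]) auto
    have gh: "g holomorphic_on S" using g SU holomorphic_on_subset by blast
    have kn: "norm (k z / z) = ?n powr Re z * norm ((1 + z^2 / of_real R ^ 2) / z)" for z
      unfolding k_def by (simp add: norm_divide norm_mult norm_of_nat_powr del: of_nat_Suc)
    note Cg = Cauchy_integral_right_arc_closed[OF S, of "\<lambda>z. g z * k z" R ?p,
        OF holomorphic_on_mult[OF gh kh] R aS bracket_path pS pslit]
    note CW = Cauchy_integral_right_arc_closed[of UNIV "\<lambda>z. W z * k z" R ?l,
        OF _ _ _ holomorphic_on_mult[OF Wh kh] R _ _ _ _ _ lslit]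
    have lends: "pathstart ?l = \<i> * R" "pathfinish ?l = - (\<i> * R)"
    proof -
      have "cis (3*pi/2) = - \<i>" using cis_mult[of pi "pi/2"] by (simp add: field_simps)
      then show "pathstart ?l = \<i> * R" "pathfinish ?l = - (\<i> * R)"
        by (simp_all add: cis_conv_exp[symmetric] complex_eq_iff Re_exp Im_exp cos_3over2_pi sin_3over2_pi)
    qed
    have CW1: "contour_integral ?a (\<lambda>z. W z * k z / z) + contour_integral ?l (\<lambda>z. W z * k z / z) = 2 * pi * \<i> * (W 0 * k 0)"
      and CW2: "(\<lambda>z. W z * k z / z) contour_integrable_on ?a" and CW3: "(\<lambda>z. W z * k z / z) contour_integrable_on ?l"
      using CW lends by auto
    have diffa: "((\<lambda>z. (g z - W z) * (k z / z)) has_contour_integral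
        (contour_integral ?a (\<lambda>z. g z * k z / z) - contour_integral ?a (\<lambda>z. W z * k z / z))) ?a"
      using has_contour_integral_diff[OF has_contour_integral_integral[OF Cg(2)] has_contour_integral_integral[OF CW2]]
      by (simp add: left_diff_distrib diff_divide_distrib)
    have ba: "norm (contour_integral ?a (\<lambda>z. g z * k z / z) - contour_integral ?a (\<lambda>z. W z * k z / z))
        \<le> (2 * B / R^2) * R * (pi/2 - (-pi/2))"
    proof (rule has_contour_integral_bound_part_circlepath_strong[OF diffa, of "{\<i> * R, - (\<i> * R)}"])
      fix z assume z: "z \<in> path_image ?a - {\<i> * R, - (\<i> * R)}"
      have nz: "norm z = R" and Re: "Re z \<ge> 0" using right_arc_memD[OF _ R] z by auto
      have "Re z \<noteq> 0"
      proof
        assume "Re z = 0"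
        then have "\<bar>Im z\<bar> = R" using nz by (simp add: cmod_def)
        with \<open>Re z = 0\<close> z show False by (auto simp: complex_eq_iff abs_if split: if_splits)
      qed
      with Re have pos: "Re z > 0" by simp
      have "norm (g z - W z) \<le> B * ?n powr - Re z / Re z"
        unfolding W_def by (rule Newman_sum_bounds(1)[OF bound B pos sums[OF pos]])
      then have "norm ((g z - W z) * (k z / z)) \<le> (B * ?n powr - Re z / Re z) * (?n powr Re z * (2 * \<bar>Re z\<bar> / R^2))"
        unfolding norm_mult kn norm_Newman_kernel[OF nz R] by (rule mult_right_mono) auto
      also have "\<dots> = 2 * B / R^2" using pos by (simp add: powr_minus field_simps)
      finally show "norm ((g z - W z) * (k z / z)) \<le> 2 * B / R^2" .
    qed (use B R in auto)
    have bl: "norm (contour_integral ?l (\<lambda>z. W z * k z / z)) \<le> (2 * B / R^2) * R * (3*pi/2 - pi/2)"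
    proof (rule has_contour_integral_bound_part_circlepath_strong[OF has_contour_integral_integral[OF CW3], of "{\<i> * R, - (\<i> * R)}"])
      fix z assume z: "z \<in> path_image ?l - {\<i> * R, - (\<i> * R)}"
      have nz: "norm z = R" and Re: "Re z \<le> 0" using left_arc_memD[OF _ R] z by auto
      have "Re z \<noteq> 0"
      proof
        assume "Re z = 0"
        then have "\<bar>Im z\<bar> = R" using nz by (simp add: cmod_def)
        with \<open>Re z = 0\<close> z show False by (auto simp: complex_eq_iff abs_if split: if_splits)
      qed
      with Re have pos: "Re z < 0" by simp
      have "norm (W z) \<le> B * ?n powr - Re z / \<bar>Re z\<bar>"
        unfolding W_def by (rule Newman_sum_bounds(2)[OF bound B pos])
      then have "norm (W z * (k z / z)) \<le> (B * ?n powr - Re z / \<bar>Re z\<bar>) * (?n powr Re z * (2 * \<bar>Re z\<bar> / R^2))"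
        unfolding norm_mult kn norm_Newman_kernel[OF nz R] by (rule mult_right_mono) auto
      also have "\<dots> = 2 * B / R^2" using pos by (simp add: powr_minus field_simps)
      finally show "norm (W z * k z / z) \<le> 2 * B / R^2" by simp
    qed (use B R in auto)
    have ln: "ln ?n > 0" using N by simp
    have bp: "norm (contour_integral ?p (\<lambda>z. g z * k z / z)) \<le> D / ln ?n * (2 * d + 2 * R)"
    proof (rule norm_contour_integral_bracket_path_le[OF Cg(3) R d(1)])
      show "D / ln ?n \<ge> 0" using M d R ln by (simp add: D_def)
      fix z assume z: "z \<in> path_image ?p"
      have zn: "norm z < 2 * R" "norm z \<ge> d" using pnorm[OF z] by auto
      have zR: "- d \<le> Re z" "Re z \<le> 0" using bracket_path_memD[OF z R d(1)] d by auto
      have p1: "?n powr Re z * \<bar>Re z\<bar> \<le> 1 / ln ?n" using powr_mult_neg_le_inverse_ln[of ?n "Re z"] zR N by simp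
      have q: "?n powr Re z * norm (1 + z^2 / of_real R ^ 2) \<le> 1 / ln ?n * (4 / R + 5 / d)"
        using bracket_path_memD[OF z R d(1)]
      proof
        assume c: "\<bar>Im z\<bar> = R \<and> - d \<le> Re z \<and> Re z \<le> 0"
        have "1 + z^2 / of_real R ^ 2 = (z^2 + of_real R ^ 2) / of_real R ^ 2" using R by (simp add: field_simps)
        also have "z^2 + of_real R ^ 2 = of_real (Re z) * (z + \<i> * Im z)"
        proof -
          have "of_real R ^ 2 = (of_real (Im z) ^ 2 :: complex)" using c by (metis of_real_power power2_abs)
          then show ?thesis by (auto simp: complex_eq_iff power2_eq_square algebra_simps)
        qed
        finally have "norm (1 + z^2 / of_real R ^ 2) = \<bar>Re z\<bar> * norm (z + \<i> * Im z) / R^2"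
          by (simp add: norm_divide norm_mult norm_power)
        moreover have "norm (z + \<i> * Im z) \<le> 4 * R"
          using norm_triangle_ineq[of z "\<i> * Im z"] zn c R by (simp add: norm_mult)
        ultimately have "norm (1 + z^2 / of_real R ^ 2) \<le> \<bar>Re z\<bar> * (4 * R) / R^2"
          using R by (auto intro!: divide_right_mono mult_left_mono)
        also have "\<dots> = \<bar>Re z\<bar> * (4 / R)" using R by (simp add: power2_eq_square)
        finally have "?n powr Re z * norm (1 + z^2 / of_real R ^ 2) \<le> ?n powr Re z * (\<bar>Re z\<bar> * (4 / R))"
          by (rule mult_left_mono) auto
        also have "\<dots> = ?n powr Re z * \<bar>Re z\<bar> * (4 / R)" by simp
        also have "\<dots> \<le> 1 / ln ?n * (4 / R)" using p1 R by (intro mult_right_mono) auto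
        also have "\<dots> \<le> 1 / ln ?n * (4 / R + 5 / d)" using ln R d by (intro mult_left_mono) auto
        finally show ?thesis .
      next
        assume c: "Re z = - d \<and> \<bar>Im z\<bar> \<le> R"
        have "norm (1 + z^2 / of_real R ^ 2) \<le> 1 + norm z ^ 2 / R^2"
          using norm_triangle_ineq[of 1 "z^2 / of_real R ^ 2"] by (simp add: norm_divide norm_power)
        also have "norm z ^ 2 \<le> (2 * R) ^ 2" using zn by (intro power_mono) auto
        then have "1 + norm z ^ 2 / R^2 \<le> 1 + (2*R)^2 / R^2" by (intro add_left_mono divide_right_mono) auto
        also have "\<dots> = 5" using R by (simp add: power2_eq_square)
        finally have "?n powr Re z * norm (1 + z^2 / of_real R ^ 2) \<le> ?n powr Re z * 5"
          by (rule mult_left_mono) auto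
        also have "\<dots> = (?n powr Re z * \<bar>Re z\<bar>) * (5 / d)" using c d by simp
        also have "\<dots> \<le> 1 / ln ?n * (5 / d)" using p1 d by (intro mult_right_mono) auto
        also have "\<dots> \<le> 1 / ln ?n * (4 / R + 5 / d)" using ln R d by (intro mult_left_mono) auto
        finally show ?thesis .
      qed
      have "norm (g z * k z / z) = norm (g z) / norm z * (?n powr Re z * norm (1 + z^2 / of_real R ^ 2))"
        unfolding k_def by (simp add: norm_divide norm_mult norm_of_nat_powr del: of_nat_Suc)
      also have "\<dots> \<le> M / d * (1 / ln ?n * (4 / R + 5 / d))"
        by (rule mult_mono[OF frac_le q]) (use M(2)[OF z] zn d M(1) in auto)
      also have "\<dots> = D / ln ?n" by (simp add: D_def)
      finally show "norm (g z * k z / z) \<le> D / ln ?n" .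
    qed
    have "2 * pi * \<i> * (g 0 - W 0) =
      (contour_integral ?a (\<lambda>z. g z * k z / z) - contour_integral ?a (\<lambda>z. W z * k z / z))
      + contour_integral ?p (\<lambda>z. g z * k z / z) - contour_integral ?l (\<lambda>z. W z * k z / z)"
      using Cg(1) CW1 by (simp add: k0 algebra_simps)
    then have "norm (2 * pi * \<i> * (g 0 - W 0)) \<le> (2 * B / R^2) * R * (pi/2 - (-pi/2))
      + D / ln ?n * (2 * d + 2 * R) + (2 * B / R^2) * R * (3*pi/2 - pi/2)"
      using norm_triangle_ineq4 norm_triangle_ineq ba bp bl by (smt (verit))
    also have "(2 * B / R^2) * R * (pi/2 - (-pi/2)) = 2 * pi * B / R" using R by (simp add: power2_eq_square)
    also have "(2 * B / R^2) * R * (3*pi/2 - pi/2) = 2 * pi * B / R" using R by (simp add: power2_eq_square)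
    also have "2 * pi * B / R + D / ln ?n * (2 * d + 2 * R) + 2 * pi * B / R
        = 4 * pi * B / R + D * (2 * d + 2 * R) / ln ?n" by simp
    also have "norm (2 * pi * \<i> * (g 0 - W 0)) = 2 * pi * norm (g 0 - W 0)"
      by (simp only: norm_mult) simp
    finally show "2 * pi * norm (g 0 - (\<Sum>n<N. w n 0)) \<le> 4 * pi * B / R + D * (2 * d + 2 * R) / ln ?n"
      by (simp only: W_def)
  qed
qed

theorem Newman_tauberian:
  fixes w :: "nat \<Rightarrow> complex \<Rightarrow> complex"
  assumes hol: "\<And>n. w n holomorphic_on UNIV"
    and bound: "\<And>n z. Re z \<noteq> 0 \<Longrightarrow>
      norm (w n z) \<le> B * (real (Suc n) powr - Re z - real (Suc (Suc n)) powr - Re z) / Re z"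
    and B: "B \<ge> 0" and U: "open U" "{z. Re z \<ge> 0} \<subseteq> U" and g: "g holomorphic_on U"
    and sums: "\<And>z. Re z > 0 \<Longrightarrow> (\<lambda>n. w n z) sums g z"
  shows "(\<lambda>n. w n 0) sums g 0"
  unfolding sums_def
proof (rule LIMSEQ_I)
  fix r :: real assume r: "r > 0"
  define R where "R = 4 * (B + 1) / r"
  have R: "R > 0" using B r by (simp add: R_def)
  obtain C where C: "\<And>N. N \<ge> 1 \<Longrightarrow> 2 * pi * norm (g 0 - (\<Sum>n<N. w n 0)) \<le> 4 * pi * B / R + C / ln (Suc N)"
    using Newman_estimate[OF hol bound B U g sums R] by blast
  have "((\<lambda>N. C / ln (real (Suc N))) \<longlonglongrightarrow> 0)" by real_asymp
  then have "eventually (\<lambda>N. C / ln (real (Suc N)) < pi * r) sequentially"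
    using r by (intro order_tendstoD) auto
  then obtain N0 where N0: "\<And>N. N \<ge> N0 \<Longrightarrow> C / ln (real (Suc N)) < pi * r"
    unfolding eventually_sequentially by blast
  show "\<exists>no. \<forall>n\<ge>no. norm ((\<Sum>i<n. w i 0) - g 0) < r"
  proof (intro exI allI impI)
    fix N assume N: "N \<ge> max 1 N0"
    have "4 * pi * B / R = pi * (r * (B / (B + 1)))" using B r by (simp add: R_def field_simps)
    also have "\<dots> \<le> pi * r" using B r by (simp add: field_simps)
    finally have "2 * pi * norm (g 0 - (\<Sum>n<N. w n 0)) < pi * r + pi * r"
      using C[of N] N0[of N] N unfolding max.bounded_iff by linarith
    then have "(2 * pi) * norm (g 0 - (\<Sum>n<N. w n 0)) < (2 * pi) * r" by simp
    then have "norm (g 0 - (\<Sum>n<N. w n 0)) < r" by (subst (asm) mult_less_cancel_left_pos) auto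
    then show "norm ((\<Sum>i<N. w i 0) - g 0) < r" by (simp add: norm_minus_commute)
  qed
qed

section \<open>Zeta and its logarithmic derivative\<close>

lemma dirichlet_convolution_sums:
  fixes f g :: "nat \<Rightarrow> complex"
  assumes f: "summable (\<lambda>n. norm (f n))" "f 0 = 0" and g: "summable (\<lambda>n. norm (g n))" "g 0 = 0"
  shows "(\<lambda>n. \<Sum>d | d dvd n. f d * g (n div d)) sums (suminf f * suminf g)"
proof -
  let ?A = "{1::nat..}"
  have hs: "(u has_sum suminf u) ?A" and abs: "(\<lambda>n. norm (u n)) summable_on ?A"
    if "summable (\<lambda>n. norm (u n))" "u 0 = 0" for u :: "nat \<Rightarrow> complex"
  proof -
    have "(u has_sum suminf u) UNIV"
      using that by (intro norm_summable_imp_has_sum) (auto dest: summable_norm_cancel)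
    then show "(u has_sum suminf u) ?A"
      using that by (subst has_sum_cong_neutral[of UNIV _ u u]) (auto simp: not_less_eq_eq)
    have "(\<lambda>n. norm (u n)) summable_on UNIV"
      using that by (intro norm_summable_imp_summable_on) auto
    then show "(\<lambda>n. norm (u n)) summable_on ?A" by (rule summable_on_subset_banach) auto
  qed
  have "(\<lambda>x. norm (case x of (d, m) \<Rightarrow> f d * g m)) summable_on (?A \<times> ?A)"
    unfolding Infinite_Sum.abs_summable_on_Sigma_iff
    using hs[OF f] hs[OF g] abs[OF f] abs[OF g]
    by (auto simp: norm_mult infsum_cmult_right' abs_mult intro!: summable_on_cmult_right summable_on_cmult_left)
  then have "(\<lambda>(d, m). f d * g m) summable_on (?A \<times> ?A)" by (rule Infinite_Sum.abs_summable_summable)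
  then have prod: "((\<lambda>(d, m). f d * g m) has_sum (suminf f * suminf g)) (?A \<times> ?A)"
    by (intro has_sum_SigmaI[where g = "\<lambda>d. f d * suminf g"])
       (unfold case_prod_conv, rule has_sum_cmult_right[OF hs[OF g]], rule has_sum_cmult_left[OF hs[OF f]])
  have bij: "((\<lambda>(n, d). f d * g (n div d)) has_sum S) (Sigma ?A (\<lambda>n. {d. d dvd n}))
     = ((\<lambda>(d, m). f d * g m) has_sum S) (?A \<times> ?A)" for S
    by (rule has_sum_reindex_bij_witness[of _ "\<lambda>(d, m). (d * m, d)" "\<lambda>(n, d). (d, n div d)"])
       (auto simp: Suc_le_eq elim!: dvdE intro: Nat.gr0I)
  have "((\<lambda>n. \<Sum>d | d dvd n. f d * g (n div d)) has_sum (suminf f * suminf g)) ?A"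
    using prod[folded bij] by (rule has_sum_SigmaD) (auto intro!: has_sum_finiteI)
  moreover have "(\<Sum>d | d dvd (0::nat). f d * g (0 div d)) = 0" using g by simp
  ultimately have "((\<lambda>n. \<Sum>d | d dvd n. f d * g (n div d)) has_sum (suminf f * suminf g)) UNIV"
    by (subst has_sum_cong_neutral[of ?A]) (auto simp: not_less_eq_eq)
  then show ?thesis by (rule has_sum_imp_sums)
qed

lemma summable_ln_powr:
  assumes "s > (1 :: real)"
  shows "summable (\<lambda>n. ln (real n) * real n powr - s)"
proof (rule summable_comparison_test_ev)
  define e where "e = (s - 1) / 2"
  have e: "e > 0" using assms by (simp add: e_def)
  show "summable (\<lambda>n. 1 / e * real n powr (- s + e))"
    using assms by (intro summable_mult) (auto simp: summable_real_powr_iff e_def field_simps)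
  show "\<forall>\<^sub>F n in sequentially. norm (ln (real n) * real n powr - s) \<le> 1 / e * real n powr (- s + e)"
    using eventually_gt_at_top[of 1]
  proof eventually_elim
    case (elim n)
    have "ln (real n) \<le> real n powr e / e" using e elim by (intro ln_powr_bound) auto
    then have "ln (real n) * real n powr - s \<le> real n powr e / e * real n powr - s" by (intro mult_right_mono) auto
    moreover have "real n powr (- s + e) = real n powr e * real n powr - s"
      by (metis powr_add mult.commute)
    ultimately show ?case using elim by (simp only:) (simp add: abs_mult)
  qed
qed

definition zeta_series :: "complex \<Rightarrow> complex" where "zeta_series s = (\<Sum>n. of_nat n powr - s)"
definition mangoldt_series :: "complex \<Rightarrow> complex" where "mangoldt_series s = (\<Sum>n. mangoldt n * of_nat n powr - s)"

lemma summable_zeta_series: "Re s > 1 \<Longrightarrow> summable (\<lambda>n. norm (of_nat n powr - s :: complex))"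
  by (simp add: norm_of_nat_powr summable_real_powr_iff)

lemma summable_mangoldt_series:
  fixes s :: complex
  assumes "Re s > 1"
  shows "summable (\<lambda>n. norm (mangoldt n * of_nat n powr - s :: complex))"
proof (rule summable_comparison_test_ev[OF _ summable_ln_powr[OF assms]])
  show "\<forall>\<^sub>F n in sequentially. norm (norm (mangoldt n * of_nat n powr - s :: complex)) \<le> ln (real n) * real n powr - Re s"
    using eventually_gt_at_top[of 0]
    by eventually_elim (auto simp: norm_mult norm_of_nat_powr mangoldt_le abs_mult intro!: mult_right_mono)
qed

lemma ln_sums_mangoldt_series_zeta_series:
  fixes s :: complex
  assumes s: "Re s > 1"
  shows "(\<lambda>n. ln (real n) * of_nat n powr - s) sums (mangoldt_series s * zeta_series s)"
proof -
  have "(\<Sum>d | d dvd n. (mangoldt d * of_nat d powr - s) * of_nat (n div d) powr - s)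
      = ln (real n) * of_nat n powr - s" for n
  proof (cases "n = 0")
    case False
    have "(\<Sum>d | d dvd n. (mangoldt d * of_nat d powr - s) * of_nat (n div d) powr - s)
       = (\<Sum>d | d dvd n. mangoldt d * of_nat n powr - s)"
    proof (intro sum.cong refl)
      fix d assume "d \<in> {d. d dvd n}"
      then obtain m where m: "n = d * m" by auto
      then have "d > 0" "m > 0" using False by auto
      have "of_nat d powr - s * of_nat m powr - s = (of_nat n powr - s :: complex)"
        using m by (simp add: powr_times_real)
      then show "(mangoldt d * of_nat d powr - s) * of_nat (n div d) powr - s = mangoldt d * of_nat n powr - s"
        using m \<open>d > 0\<close> by (simp add: mult.assoc)
    qed
    also have "\<dots> = ln (real n) * of_nat n powr - s"
      using mangoldt_sum[OF False, where ?'a = complex] by (simp flip: sum_distrib_right)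
    finally show ?thesis .
  qed simp
  then show ?thesis
    using dirichlet_convolution_sums[OF summable_mangoldt_series[OF s] _ summable_zeta_series[OF s]]
    by (simp add: mangoldt_series_def zeta_series_def)
qed

text \<open>\<open>hzeta s = (s - 1) \<zeta>(s)\<close>; the factor \<open>s - 1\<close> removes the pole and makes every term entire.\<close>

definition hterm :: "nat \<Rightarrow> complex \<Rightarrow> complex" where
  "hterm n s = (s - 1) * of_nat (Suc n) powr - s - of_nat (Suc n) powr (1 - s) + of_nat (Suc (Suc n)) powr (1 - s)"

definition hzeta :: "complex \<Rightarrow> complex" where
  "hzeta s = 1 + (\<Sum>n. hterm n s)"

lemma has_field_derivative_of_real_powr:
  fixes s :: complex
  assumes "x > 0"
  shows "((\<lambda>z. z powr s) has_field_derivative s * of_real x powr (s - 1)) (at (of_real x) within A)"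
  using assms by (intro has_field_derivative_at_within[OF has_field_derivative_powr]) auto

lemma norm_of_real_powr: "x \<ge> 0 \<Longrightarrow> norm (of_real x powr z :: complex) = x powr Re z"
  using norm_powr_real_powr[of "of_real x" z] by simp

lemma convex_of_real_image: "convex A \<Longrightarrow> convex (complex_of_real ` A)"
  by (intro convex_linear_image) (auto simp: bounded_linear_of_real bounded_linear.linear)

lemma norm_hterm_le:
  assumes s: "Re s > 0"
  shows "norm (hterm n s) \<le> norm s * norm (s - 1) * real (Suc n) powr (- Re s - 1)"
proof -
  define a where "a = real (Suc n)"
  have a: "a > 0" by (simp add: a_def)
  define A where "A = complex_of_real ` {a..a + 1}"
  have A: "convex A" "of_real a \<in> A" "of_real (a + 1) \<in> A"
    unfolding A_def by (auto intro!: convex_of_real_image imageI simp del: of_real_add)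
  define C where "C = norm s * a powr (- Re s - 1)"
  have C: "norm (of_real x powr - s - of_real a powr - s :: complex) \<le> C" if x: "x \<in> {a..a+1}" for x
  proof -
    have "norm (of_real x powr - s - of_real a powr - s) \<le> C * norm (of_real x - of_real a :: complex)"
    proof (rule field_differentiable_bound[OF A(1)])
      fix z assume "z \<in> A"
      then obtain y where y: "z = of_real y" "y \<in> {a..a+1}" by (auto simp: A_def)
      then show "((\<lambda>z. z powr - s) has_field_derivative - s * z powr (- s - 1)) (at z within A)"
        using a has_field_derivative_of_real_powr[of y "-s"] by auto
      have "y powr (- Re s - 1) \<le> a powr (- Re s - 1)" using y a s by (intro powr_mono2') auto
      then show "norm (- s * z powr (- s - 1)) \<le> C"
        using y a by (simp add: norm_mult norm_of_real_powr C_def mult_left_mono)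
    qed (use x A in \<open>auto simp: A_def\<close>)
    also have "\<dots> = C * \<bar>x - a\<bar>" by (simp flip: of_real_diff)
    also have "\<dots> \<le> C * 1" using x by (intro mult_left_mono) (auto simp: C_def)
    finally show ?thesis by simp
  qed
  define f where "f z = z powr (1 - s) + (s - 1) * of_real a powr - s * z" for z
  have "norm (f (of_real (a + 1)) - f (of_real a)) \<le> (norm (s - 1) * C) * norm (of_real (a + 1) - of_real a :: complex)"
  proof (rule field_differentiable_bound[OF A(1)])
    fix z assume "z \<in> A"
    then obtain y where y: "z = of_real y" "y \<in> {a..a+1}" by (auto simp: A_def)
    have "((\<lambda>z. z powr (1 - s)) has_field_derivative (1 - s) * z powr - s) (at z within A)"
      using y a has_field_derivative_of_real_powr[of y "1 - s"] by simp
    from DERIV_add[OF this DERIV_cmult_Id[of "(s - 1) * of_real a powr - s"]]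
    show "(f has_field_derivative (s - 1) * (of_real a powr - s - z powr - s)) (at z within A)"
      unfolding f_def by (rule DERIV_cong) (simp add: algebra_simps)
    show "norm ((s - 1) * (of_real a powr - s - z powr - s)) \<le> norm (s - 1) * C"
      unfolding norm_mult using C[OF y(2)] y(1) by (intro mult_left_mono) (auto simp: norm_minus_commute)
  qed (use A in auto)
  moreover have "f (of_real (a + 1)) - f (of_real a) = hterm n s"
    by (simp add: f_def hterm_def a_def algebra_simps)
  ultimately show ?thesis by (simp add: C_def a_def mult_ac)
qed

lemma hzeta_uniform_limit:
  assumes "Re z > 0"
  defines "d \<equiv> Re z / 2"
  shows "d > 0" "cball z d \<subseteq> {s. Re s > 0}"
    "uniform_limit (cball z d) (\<lambda>N s. 1 + (\<Sum>n<N. hterm n s)) hzeta sequentially"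
proof -
  show d: "d > 0" using assms by simp
  have Re: "Re s \<ge> d" if "s \<in> cball z d" for s
    using that abs_Re_le_cmod[of "z - s"] by (simp add: dist_norm d_def)
  then show "cball z d \<subseteq> {s. Re s > 0}" using d by fastforce
  define M where "M = norm z + d + 1"
  have "uniform_limit (cball z d) (\<lambda>N s. \<Sum>n<N. hterm n s) (\<lambda>s. \<Sum>n. hterm n s) sequentially"
  proof (rule Weierstrass_m_test)
    fix n s assume s: "s \<in> cball z d"
    have ns: "norm s \<le> norm z + d" using s norm_triangle_sub[of s z] by (simp add: dist_norm norm_minus_commute)
    have "norm (hterm n s) \<le> norm s * norm (s - 1) * real (Suc n) powr (- Re s - 1)"
      using Re[OF s] d by (intro norm_hterm_le) auto
    also have "\<dots> \<le> M * M * real (Suc n) powr (- d - 1)"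
      using Re[OF s] d ns norm_triangle_ineq4[of s 1]
      by (intro mult_mono powr_mono) (auto simp: M_def)
    finally show "norm (hterm n s) \<le> M * M * real (Suc n) powr (- d - 1)" .
  next
    have "summable (\<lambda>n. real n powr (- d - 1))" using d by (simp add: summable_real_powr_iff)
    then have "summable (\<lambda>n. real (Suc n) powr (- d - 1))" by (subst summable_Suc_iff)
    then show "summable (\<lambda>n. M * M * real (Suc n) powr (- d - 1))" by (rule summable_mult)
  qed
  then show "uniform_limit (cball z d) (\<lambda>N s. 1 + (\<Sum>n<N. hterm n s)) hzeta sequentially"
    unfolding hzeta_def by (intro uniform_limit_intros)
qed

lemma holomorphic_hterm: "hterm n holomorphic_on A"
  unfolding hterm_def[abs_def] by (intro holomorphic_intros)

lemma holomorphic_hzeta: "hzeta holomorphic_on {s. Re s > 0}"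
proof (rule holomorphic_uniform_sequence[where f = "\<lambda>N s. 1 + (\<Sum>n<N. hterm n s)"])
  show "open {s. Re s > 0}" by (rule open_halfspace_Re_gt)
  show "(\<lambda>s. 1 + (\<Sum>n<N. hterm n s)) holomorphic_on {s. Re s > 0}" for N
    by (intro holomorphic_intros holomorphic_hterm)
qed (use hzeta_uniform_limit in blast)

lemma hzeta_1: "hzeta 1 = 1"
  using of_nat_neq_0[where ?'a = complex] by (simp add: hzeta_def hterm_def del: of_nat_Suc)

lemma sum_hterm:
  "1 + (\<Sum>n<N. hterm n s) = (s - 1) * (\<Sum>n\<le>N. of_nat n powr - s) + of_nat (Suc N) powr (1 - s)"
proof (induction N)
  case (Suc N)
  have "1 + (\<Sum>n<Suc N. hterm n s) = ((s - 1) * (\<Sum>n\<le>N. of_nat n powr - s) + of_nat (Suc N) powr (1 - s)) + hterm N s"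
    using Suc.IH by (simp add: add.assoc[symmetric] del: of_nat_Suc)
  also have "\<dots> = (s - 1) * (\<Sum>n\<le>Suc N. of_nat n powr - s) + of_nat (Suc (Suc N)) powr (1 - s)"
    by (simp add: hterm_def algebra_simps del: of_nat_Suc)
  finally show ?case .
qed simp

lemma tendsto_of_nat_Suc_powr:
  assumes "Re s > 1"
  shows "(\<lambda>N. of_nat (Suc N) powr (1 - s) :: complex) \<longlonglongrightarrow> 0"
    "(\<lambda>N. of_real (ln (real (Suc N))) * of_nat (Suc N) powr (1 - s) :: complex) \<longlonglongrightarrow> 0"
proof -
  have "(\<lambda>N. real (Suc N) powr (1 - Re s)) \<longlonglongrightarrow> 0" using assms by real_asymp
  then show "(\<lambda>N. of_nat (Suc N) powr (1 - s) :: complex) \<longlonglongrightarrow> 0"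
    by (subst tendsto_norm_zero_iff[symmetric]) (simp add: norm_of_nat_powr del: of_nat_Suc)
  have "(\<lambda>N. ln (real (Suc N)) * real (Suc N) powr (1 - Re s)) \<longlonglongrightarrow> 0" using assms by real_asymp
  then show "(\<lambda>N. of_real (ln (real (Suc N))) * of_nat (Suc N) powr (1 - s) :: complex) \<longlonglongrightarrow> 0"
    by (subst tendsto_norm_zero_iff[symmetric]) (simp add: norm_mult norm_of_nat_powr del: of_nat_Suc)
qed

lemma hzeta_eq_zeta_series:
  assumes "Re s > 1"
  shows "hzeta s = (s - 1) * zeta_series s"
proof -
  have "(\<lambda>N. 1 + (\<Sum>n<N. hterm n s)) \<longlonglongrightarrow> hzeta s"
    by (rule tendsto_uniform_limitI[OF hzeta_uniform_limit(3)[of s]]) (use assms in auto)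
  moreover have "(\<lambda>N. (s - 1) * (\<Sum>n\<le>N. of_nat n powr - s) + of_nat (Suc N) powr (1 - s)) \<longlonglongrightarrow> (s - 1) * zeta_series s + 0"
    unfolding zeta_series_def using summable_zeta_series[OF assms]
    by (intro tendsto_intros tendsto_of_nat_Suc_powr assms summable_LIMSEQ') (auto dest: summable_norm_cancel)
  ultimately show ?thesis unfolding sum_hterm by (simp add: LIMSEQ_unique)
qed

lemma deriv_hzeta_eq:
  assumes "Re s > 1"
  shows "deriv hzeta s = zeta_series s - (s - 1) * (mangoldt_series s * zeta_series s)"
proof -
  define f' where "f' N s = (\<Sum>n\<le>N. of_nat n powr - s) - (s - 1) * (\<Sum>n\<le>N. ln (real n) * of_nat n powr - s)
     - ln (real (Suc N)) * of_nat (Suc N) powr (1 - s)" for N and s :: complex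
  have df: "((\<lambda>s. 1 + (\<Sum>n<N. hterm n s)) has_field_derivative f' N s) (at s)" for N s
  proof -
    have 1: "((\<lambda>s. of_nat n powr - s) has_field_derivative - (ln (real n) * of_nat n powr - s)) (at s)" for n
    proof (cases "n = 0")
      case False
      then have "of_nat n \<noteq> (0 :: complex)" by simp
      from DERIV_chain2[OF has_field_derivative_powr_right[OF this] DERIV_minus[OF DERIV_ident]]
      show ?thesis using False by (simp add: Ln_of_nat)
    qed simp
    have 2: "((\<lambda>s. of_nat (Suc N) powr (1 - s)) has_field_derivative - (ln (real (Suc N)) * of_nat (Suc N) powr (1 - s))) (at s)"
      using DERIV_chain2[OF has_field_derivative_powr_right[OF of_nat_neq_0[of N]] DERIV_diff[OF DERIV_const[of 1] DERIV_ident]]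
      by (simp add: Ln_of_nat del: of_nat_Suc)
    show ?thesis unfolding sum_hterm f'_def
      by (rule derivative_eq_intros 1 2 refl)+ (simp add: sum_negf)
  qed
  have s: "Re s > 0" using assms by simp
  note h = hzeta_uniform_limit[OF s]
  obtain g' where g': "\<And>w. w \<in> ball s (Re s / 2) \<Longrightarrow> (hzeta has_field_derivative g' w) (at w) \<and> ((\<lambda>N. f' N w) \<longlonglongrightarrow> g' w)"
    by (rule has_complex_derivative_uniform_limit[OF _ h(3) _ h(1), of f'])
       (use df in \<open>auto intro!: always_eventually holomorphic_on_imp_continuous_on holomorphic_intros holomorphic_hterm\<close>)
  have "(hzeta has_field_derivative g' s) (at s)" "(\<lambda>N. f' N s) \<longlonglongrightarrow> g' s" using g'[of s] h(1) by auto
  moreover have "(\<lambda>N. f' N s) \<longlonglongrightarrow> zeta_series s - (s - 1) * (mangoldt_series s * zeta_series s) - 0"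
    unfolding f'_def zeta_series_def using ln_sums_mangoldt_series_zeta_series[OF assms, unfolded sums_def_le] summable_zeta_series[OF assms]
    by (intro tendsto_intros tendsto_of_nat_Suc_powr assms summable_LIMSEQ') (auto simp: zeta_series_def dest: summable_norm_cancel)
  ultimately show ?thesis by (auto simp: DERIV_imp_deriv LIMSEQ_unique)
qed

lemma mangoldt_series_hzeta:
  assumes "Re s > 1"
  shows "(s - 1) * deriv hzeta s = hzeta s * (1 - (s - 1) * mangoldt_series s)"
  by (simp add: deriv_hzeta_eq[OF assms] hzeta_eq_zeta_series[OF assms] algebra_simps)

lemma log_deriv_tendsto_order:
  fixes f :: "complex \<Rightarrow> complex"
  assumes f: "f holomorphic_on S" and S: "open S" "connected S" "z \<in> S"
    and nz: "\<exists>w\<in>S. f w \<noteq> 0"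
  obtains m :: nat where "((\<lambda>e. of_real e * (deriv f (z + of_real e) / f (z + of_real e))) \<longlongrightarrow> of_nat m) (at_right 0)"
    "f z = 0 \<Longrightarrow> m \<ge> 1" "eventually (\<lambda>e. f (z + of_real e) \<noteq> 0) (at_right 0)"
proof -
  have "\<exists>g r n. 0 < r \<and> g holomorphic_on ball z r \<and> (\<forall>w\<in>ball z r. f w = (w - z) ^ n * g w \<and> g w \<noteq> 0)
      \<and> (f z = 0 \<longrightarrow> n \<ge> 1)"
  proof (cases "f z = 0")
    case True
    have nc: "\<not> f constant_on S" using True nz S(3) by (metis constant_on_def)
    obtain g r n where "0 < n" "0 < r" "ball z r \<subseteq> S" "g holomorphic_on ball z r"
      "\<And>w. w \<in> ball z r \<Longrightarrow> f w = (w - z) ^ n * g w" "\<And>w. w \<in> ball z r \<Longrightarrow> g w \<noteq> 0"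
      by (rule holomorphic_factor_zero_nonconstant[OF f S True nc]) (rule that)
    then show ?thesis by (intro exI[of _ g] exI[of _ r] exI[of _ n]) auto
  next
    case False
    have "continuous_on S f" using f by (rule holomorphic_on_imp_continuous_on)
    then have "open (S \<inter> f -` (- {0}))" using S(1) by (intro continuous_open_preimage) auto
    then obtain r where "r > 0" "ball z r \<subseteq> S \<inter> f -` (- {0})" using False S(3) by (auto elim: openE)
    moreover from this have "f holomorphic_on ball z r" using holomorphic_on_subset[OF f] by blast
    ultimately show ?thesis using False
      by (intro exI[of _ f] exI[of _ r] exI[of _ 0]) auto
  qed
  then obtain g r n where r: "0 < r" and g: "g holomorphic_on ball z r"
    and fg: "\<And>w. w \<in> ball z r \<Longrightarrow> f w = (w - z) ^ n * g w" and g0: "\<And>w. w \<in> ball z r \<Longrightarrow> g w \<noteq> 0"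
    and n: "f z = 0 \<Longrightarrow> n \<ge> 1" by blast
  have ev: "eventually (\<lambda>e. e \<in> {0<..<r}) (at_right 0)" using r by (rule eventually_at_right_real)
  have key: "of_real e * (deriv f (z + of_real e) / f (z + of_real e))
      = of_nat n + of_real e * (deriv g (z + of_real e) / g (z + of_real e))"
    and f0: "f (z + of_real e) \<noteq> 0" if e: "e \<in> {0<..<r}" for e
  proof -
    let ?w = "z + of_real e"
    have w: "?w \<in> ball z r" using e by (simp add: dist_norm)
    have "(g has_field_derivative deriv g ?w) (at ?w)"
      using g w by (intro holomorphic_derivI) auto
    then have "((\<lambda>w. (w - z) ^ n * g w) has_field_derivative
        (of_nat n * of_real e ^ (n - 1) * g ?w + of_real e ^ n * deriv g ?w)) (at ?w)"
      by (auto intro!: derivative_eq_intros)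
    then have "(f has_field_derivative
        (of_nat n * of_real e ^ (n - 1) * g ?w + of_real e ^ n * deriv g ?w)) (at ?w)"
      by (rule has_field_derivative_transform_within_open[of _ _ _ "ball z r"]) (use w fg in auto)
    then have d: "deriv f ?w = of_nat n * of_real e ^ (n - 1) * g ?w + of_real e ^ n * deriv g ?w"
      by (rule DERIV_imp_deriv)
    have e0: "(of_real e :: complex) \<noteq> 0" and "g ?w \<noteq> 0" using e g0[OF w] by auto
    then show "f ?w \<noteq> 0" using fg[OF w] by simp
    have "of_real e * deriv f ?w = of_nat n * (of_real e ^ n * g ?w) + of_real e * (of_real e ^ n * deriv g ?w)"
      unfolding d by (cases n) (auto simp: algebra_simps)
    then show "of_real e * (deriv f ?w / f ?w) = of_nat n + of_real e * (deriv g ?w / g ?w)"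
      using fg[OF w] e0 \<open>g ?w \<noteq> 0\<close> by (simp add: field_simps)
  qed
  have cont: "isCont (\<lambda>w. deriv g w / g w) z"
  proof -
    have "(\<lambda>w. deriv g w / g w) holomorphic_on ball z r"
      using g g0 by (intro holomorphic_intros) auto
    then show ?thesis using r by (meson centre_in_ball continuous_on_eq_continuous_at holomorphic_on_imp_continuous_on open_ball)
  qed
  have lim: "((\<lambda>e. z + of_real e) \<longlongrightarrow> z) (at_right 0)"
    by (auto intro!: tendsto_eq_intros)
  have "((\<lambda>e. of_nat n + of_real e * (deriv g (z + of_real e) / g (z + of_real e))) \<longlongrightarrow>
     of_nat n + of_real 0 * (deriv g z / g z)) (at_right 0)"
    by (intro tendsto_add tendsto_mult tendsto_const tendsto_of_real tendsto_ident_at isCont_tendsto_compose[OF cont lim])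
  then have "((\<lambda>e. of_real e * (deriv f (z + of_real e) / f (z + of_real e))) \<longlongrightarrow> of_nat n) (at_right 0)"
    unfolding of_real_0 mult_zero_left add_0_right
    by (rule Lim_transform_eventually) (rule eventually_mono[OF ev key[symmetric]])
  moreover have "eventually (\<lambda>e. f (z + of_real e) \<noteq> 0) (at_right 0)"
    using eventually_mono[OF ev f0] .
  ultimately show ?thesis using n that by blast
qed

lemma mangoldt_series_tendsto:
  assumes "Re z \<ge> 1"
  obtains m :: nat where
    "((\<lambda>e. of_real e * mangoldt_series (z + of_real e)) \<longlongrightarrow> (if z = 1 then 1 else 0) - of_nat m) (at_right 0)"
    "hzeta z = 0 \<longleftrightarrow> m \<ge> 1"
proof -
  have nz: "\<exists>w\<in>{s. Re s > 0}. hzeta w \<noteq> 0" using hzeta_1 by (intro bexI[of _ 1]) auto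
  have conn: "connected {s. Re s > 0}" by (intro convex_connected convex_halfspace_Re_gt)
  have zS: "z \<in> {s. Re s > 0}" using assms by simp
  obtain m where m: "((\<lambda>e. of_real e * (deriv hzeta (z + of_real e) / hzeta (z + of_real e))) \<longlongrightarrow> of_nat m) (at_right 0)"
    "hzeta z = 0 \<Longrightarrow> m \<ge> 1" and nz: "eventually (\<lambda>e. hzeta (z + of_real e) \<noteq> 0) (at_right 0)"
    using log_deriv_tendsto_order[OF holomorphic_hzeta open_halfspace_Re_gt conn zS nz] by blast
  have m0: "m = 0" if h: "hzeta z \<noteq> 0"
  proof -
    have op: "open {s. Re s > 0}" by (rule open_halfspace_Re_gt)
    have "isCont hzeta z" "isCont (deriv hzeta) z"
      using holomorphic_on_imp_continuous_on[OF holomorphic_hzeta] zS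
        holomorphic_on_imp_continuous_on[OF holomorphic_deriv[OF holomorphic_hzeta op]] op
      by (auto simp: continuous_on_eq_continuous_at)
    then have "((\<lambda>e. of_real e * (deriv hzeta (z + of_real e) / hzeta (z + of_real e))) \<longlongrightarrow>
       of_real 0 * (deriv hzeta z / hzeta z)) (at_right 0)"
      by (intro tendsto_intros isCont_tendsto_compose[of z hzeta] isCont_tendsto_compose[of z "deriv hzeta"] h)
         (auto intro!: tendsto_eq_intros)
    from tendsto_unique[OF _ m(1) this] show ?thesis by simp
  qed
  have lim: "((\<lambda>e. of_real e / (z + of_real e - 1)) \<longlongrightarrow> (if z = 1 then 1 else 0 :: complex)) (at_right (0::real))"
  proof (cases "z = 1")
    case True
    have "eventually (\<lambda>e. 1 = of_real e / (z + of_real e - 1)) (at_right (0::real))"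
      using eventually_at_right_less[of 0] by eventually_elim (use True in auto)
    then show ?thesis using True by (auto intro: Lim_transform_eventually[OF tendsto_const])
  next
    case False
    then show ?thesis by (auto intro!: tendsto_eq_intros)
  qed
  have "eventually (\<lambda>e. of_real e / (z + of_real e - 1) - of_real e * (deriv hzeta (z + of_real e) / hzeta (z + of_real e))
      = of_real e * mangoldt_series (z + of_real e)) (at_right 0)"
    using nz eventually_at_right_less[of 0]
  proof eventually_elim
    case (elim e)
    let ?s = "z + of_real e"
    have s: "Re ?s > 1" "?s - 1 \<noteq> 0" using elim assms by (auto simp: complex_eq_iff)
    have "(?s - 1) * deriv hzeta ?s = hzeta ?s * (1 - (?s - 1) * mangoldt_series ?s)" by (rule mangoldt_series_hzeta[OF s(1)])
    then have "mangoldt_series ?s = 1 / (?s - 1) - deriv hzeta ?s / hzeta ?s"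
      using s(2) elim(1) by (simp add: divide_simps) (simp add: algebra_simps)
    then show ?case by (simp add: right_diff_distrib)
  qed
  then have "((\<lambda>e. of_real e * mangoldt_series (z + of_real e)) \<longlongrightarrow> (if z = 1 then 1 else 0) - of_nat m) (at_right 0)"
    by (rule Lim_transform_eventually[OF tendsto_diff[OF lim m(1)]])
  then show ?thesis using that m(2) m0 by (metis One_nat_def not_one_le_zero)
qed

lemma norm_mangoldt_series_le:
  assumes "Re s \<ge> c" "c > 1"
  shows "norm (mangoldt_series s) \<le> Re (mangoldt_series (of_real c))"
proof -
  have c: "Re (of_real c) > 1" using assms by simp
  have sc: "(\<lambda>n. Re (mangoldt n * of_nat n powr - of_real c)) sums Re (mangoldt_series (of_real c))"
    unfolding mangoldt_series_def
    by (intro sums_Re summable_sums summable_norm_cancel[OF summable_mangoldt_series[OF c]])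
  have eq: "Re (mangoldt n * of_nat n powr - of_real c) = mangoldt n * real n powr - c" for n
    using powr_of_real[of "real n" "- c"] by simp
  have sc': "(\<lambda>n. mangoldt n * real n powr - c) sums Re (mangoldt_series (of_real c))"
    using sc unfolding eq .
  have "norm (mangoldt_series s) \<le> (\<Sum>n. mangoldt n * real n powr - c)"
    unfolding mangoldt_series_def
  proof (rule norm_suminf_le)
    show "norm (mangoldt n * of_nat n powr - s) \<le> mangoldt n * real n powr - c" for n
      using assms mangoldt_nonneg
      by (cases "n = 0") (auto simp: norm_mult norm_of_nat_powr intro!: mult_left_mono powr_mono)
    show "summable (\<lambda>n. mangoldt n * real n powr - c)" using sc' by (simp add: sums_iff)
  qed
  then show ?thesis using sc' by (simp add: sums_iff)
qed

lemma hzeta_nonzero_Re_gt_1: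
  assumes "Re z > 1"
  shows "hzeta z \<noteq> 0"
proof -
  obtain m :: nat where m:
    "((\<lambda>e. of_real e * mangoldt_series (z + of_real e)) \<longlongrightarrow> (if z = 1 then 1 else 0) - of_nat m) (at_right 0)"
    "hzeta z = 0 \<longleftrightarrow> m \<ge> 1"
    using mangoldt_series_tendsto[of z] assms by auto
  have "z \<noteq> 1" using assms by auto
  have "((\<lambda>e. of_real e * mangoldt_series (z + of_real e)) \<longlongrightarrow> 0) (at_right 0)"
  proof (rule Lim_null_comparison)
    show "\<forall>\<^sub>F e in at_right 0. norm (of_real e * mangoldt_series (z + of_real e)) \<le> e * Re (mangoldt_series (of_real (Re z)))"
      using eventually_at_right_less[of 0]
    proof eventually_elim
      case (elim e)
      then have "norm (mangoldt_series (z + of_real e)) \<le> Re (mangoldt_series (of_real (Re z)))"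
        using assms by (intro norm_mangoldt_series_le) auto
      then have "e * norm (mangoldt_series (z + of_real e)) \<le> e * Re (mangoldt_series (of_real (Re z)))"
        using elim by (intro mult_left_mono) auto
      then show ?case using elim by (simp only: norm_mult norm_of_real abs_of_pos)
    qed
    show "((\<lambda>e. e * Re (mangoldt_series (of_real (Re z)))) \<longlongrightarrow> 0) (at_right 0)"
      by (rule tendsto_eq_intros refl | simp)+
  qed
  from tendsto_unique[OF _ m(1) this] have "m = 0" using \<open>z \<noteq> 1\<close> by simp
  then show ?thesis using m(2) by simp
qed

lemma mangoldt_series_3_4_1_nonneg:
  assumes "\<sigma> > 1"
  shows "0 \<le> 3 * Re (mangoldt_series (of_real \<sigma>)) + 4 * Re (mangoldt_series (Complex \<sigma> t)) + Re (mangoldt_series (Complex \<sigma> (2 * t)))"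
proof -
  have eq: "Re (mangoldt n * of_nat n powr - Complex \<sigma> u) = mangoldt n * real n powr - \<sigma> * cos (u * ln n)" for n u
    by (cases "n = 0") (auto simp: powr_def Re_exp Ln_of_nat)
  have s: "(\<lambda>n. mangoldt n * real n powr - \<sigma> * cos (u * ln n)) sums Re (mangoldt_series (Complex \<sigma> u))" for u
  proof -
    have "(\<lambda>n. Re (mangoldt n * of_nat n powr - Complex \<sigma> u)) sums Re (mangoldt_series (Complex \<sigma> u))"
      unfolding mangoldt_series_def using assms
      by (intro sums_Re summable_sums summable_norm_cancel[OF summable_mangoldt_series]) simp
    then show ?thesis unfolding eq .
  qed
  have total: "(\<lambda>n. 3 * (mangoldt n * real n powr - \<sigma> * cos (0 * ln n)) + 4 * (mangoldt n * real n powr - \<sigma> * cos (t * ln n))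
      + mangoldt n * real n powr - \<sigma> * cos (2 * t * ln n))
     sums (3 * Re (mangoldt_series (Complex \<sigma> 0)) + 4 * Re (mangoldt_series (Complex \<sigma> t)) + Re (mangoldt_series (Complex \<sigma> (2 * t))))"
    by (intro sums_add sums_mult s)
  have nonneg: "3 * (mangoldt n * real n powr - \<sigma> * cos (0 * ln n)) + 4 * (mangoldt n * real n powr - \<sigma> * cos (t * ln n))
      + mangoldt n * real n powr - \<sigma> * cos (2 * t * ln n) \<ge> 0" for n
  proof -
    have c: "cos (2 * t * ln n) = 2 * cos (t * ln n) ^ 2 - 1" using cos_double_cos[of "t * ln n"] by (simp add: mult.assoc)
    have "3 * (mangoldt n * real n powr - \<sigma> * cos (0 * ln n)) + 4 * (mangoldt n * real n powr - \<sigma> * cos (t * ln n))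
      + mangoldt n * real n powr - \<sigma> * cos (2 * t * ln n) = mangoldt n * real n powr - \<sigma> * (2 * (1 + cos (t * ln n)) ^ 2)"
      unfolding c by (simp add: algebra_simps power2_eq_square)
    also have "\<dots> \<ge> 0" using mangoldt_nonneg[of n] by simp
    finally show ?thesis .
  qed
  have "0 \<le> 3 * Re (mangoldt_series (Complex \<sigma> 0)) + 4 * Re (mangoldt_series (Complex \<sigma> t)) + Re (mangoldt_series (Complex \<sigma> (2 * t)))"
    by (rule sums_le[OF nonneg sums_zero total])
  then show ?thesis by (simp add: complex_of_real_def)
qed

text \<open>
  With \<open>L = mangoldt_series\<close>, multiplying \<open>3 L(1 + e) + 4 Re L(1 + e + it) + Re L(1 + e + 2it) \<ge> 0\<close> by \<open>e\<close> and letting \<open>e \<rightarrow> 0\<close> gives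
  \<open>3 - 4 m\<^sub>1 - m\<^sub>2 \<ge> 0\<close> for the orders \<open>m\<^sub>1\<close>, \<open>m\<^sub>2\<close> of the zeros at \<open>1 + it\<close> and \<open>1 + 2it\<close>.
\<close>

theorem hzeta_nonzero:
  assumes "Re z \<ge> 1"
  shows "hzeta z \<noteq> 0"
proof (cases "Re z > 1 \<or> z = 1")
  case True
  then show ?thesis using hzeta_nonzero_Re_gt_1 hzeta_1 by auto
next
  case False
  define t where "t = Im z"
  have z: "z = Complex 1 t" and t: "t \<noteq> 0" using False assms by (auto simp: t_def complex_eq_iff)
  obtain m0 :: nat where m0:
    "((\<lambda>e. of_real e * mangoldt_series (1 + of_real e)) \<longlongrightarrow> (if (1::complex) = 1 then 1 else 0) - of_nat m0) (at_right 0)"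
    "hzeta 1 = 0 \<longleftrightarrow> m0 \<ge> 1"
    using mangoldt_series_tendsto[of 1] by auto
  obtain m1 :: nat where m1:
    "((\<lambda>e. of_real e * mangoldt_series (Complex 1 t + of_real e)) \<longlongrightarrow> (if Complex 1 t = 1 then 1 else 0) - of_nat m1) (at_right 0)"
    "hzeta (Complex 1 t) = 0 \<longleftrightarrow> m1 \<ge> 1"
    using mangoldt_series_tendsto[of "Complex 1 t"] by auto
  obtain m2 :: nat where m2:
    "((\<lambda>e. of_real e * mangoldt_series (Complex 1 (2*t) + of_real e)) \<longlongrightarrow> (if Complex 1 (2*t) = 1 then 1 else 0) - of_nat m2) (at_right 0)"
    using mangoldt_series_tendsto[of "Complex 1 (2*t)"] by auto
  have "((\<lambda>e. 3 * Re (of_real e * mangoldt_series (1 + of_real e)) + 4 * Re (of_real e * mangoldt_series (Complex 1 t + of_real e))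
      + Re (of_real e * mangoldt_series (Complex 1 (2*t) + of_real e))) \<longlongrightarrow>
     3 * Re ((if (1::complex) = 1 then 1 else 0) - of_nat m0) + 4 * Re ((if Complex 1 t = 1 then 1 else 0) - of_nat m1)
     + Re ((if Complex 1 (2*t) = 1 then 1 else 0) - of_nat m2)) (at_right 0)"
    by (intro tendsto_intros m0 m1 m2)
  moreover have "eventually (\<lambda>e. 0 \<le> 3 * Re (of_real e * mangoldt_series (1 + of_real e)) + 4 * Re (of_real e * mangoldt_series (Complex 1 t + of_real e))
      + Re (of_real e * mangoldt_series (Complex 1 (2*t) + of_real e))) (at_right 0)"
    using eventually_at_right_less[of 0]
  proof eventually_elim
    case (elim e)
    have "1 + of_real e = (of_real (1 + e) :: complex)" "Complex 1 t + of_real e = Complex (1 + e) t"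
      "Complex 1 (2*t) + of_real e = Complex (1 + e) (2 * t)" by (auto simp: complex_eq_iff)
    then have "3 * Re (of_real e * mangoldt_series (1 + of_real e)) + 4 * Re (of_real e * mangoldt_series (Complex 1 t + of_real e))
      + Re (of_real e * mangoldt_series (Complex 1 (2*t) + of_real e))
      = e * (3 * Re (mangoldt_series (of_real (1 + e))) + 4 * Re (mangoldt_series (Complex (1 + e) t)) + Re (mangoldt_series (Complex (1 + e) (2 * t))))"
      by (simp only: Re_complex_of_real times_complex.sel Im_complex_of_real) (simp add: algebra_simps)
    also have "\<dots> \<ge> 0" using elim mangoldt_series_3_4_1_nonneg[of "1 + e" t] by (intro mult_nonneg_nonneg) auto
    finally show ?case .
  qed
  ultimately have "0 \<le> 3 * Re ((if (1::complex) = 1 then 1 else 0) - of_nat m0) + 4 * Re ((if Complex 1 t = 1 then 1 else 0) - of_nat m1)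
     + Re ((if Complex 1 (2*t) = 1 then 1 else 0) - of_nat m2)"
    by (rule tendsto_lowerbound) simp
  then have "m1 = 0" using t by (auto simp: complex_eq_iff)
  then show ?thesis using m1(2) z by simp
qed

section \<open>The Chebyshev function\<close>

definition psi :: "nat \<Rightarrow> real" where "psi n = (\<Sum>k\<le>n. mangoldt k)"

lemma psi_mono: "m \<le> n \<Longrightarrow> psi m \<le> psi n"
  unfolding psi_def by (intro sum_mono2) (auto simp: mangoldt_nonneg)

lemma psi_diff:
  assumes "m \<le> n"
  shows "psi n - psi m = (\<Sum>k\<in>{m<..n}. mangoldt k)"
proof -
  have "{..n} = {..m} \<union> {m<..n}" "{..m} \<inter> {m<..n} = {}" using assms by auto
  then show ?thesis unfolding psi_def by (simp add: sum.union_disjoint)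
qed

lemma psi_nonneg: "psi n \<ge> 0"
  unfolding psi_def by (intro sum_nonneg mangoldt_nonneg)

lemma ln_fact_eq_sum_mangoldt: 
  assumes "n \<le> N"
  shows "ln (fact n) = (\<Sum>d=1..N. mangoldt d * real (n div d))"
proof -
  have "ln (fact n) = (\<Sum>m=1..n. ln (real m))"
    unfolding fact_prod of_nat_prod by (rule ln_prod) auto
  also have "\<dots> = (\<Sum>m=1..n. \<Sum>d | d dvd m. mangoldt d)"
    by (intro sum.cong) (auto simp: mangoldt_sum)
  also have "\<dots> = (\<Sum>m=1..n. \<Sum>d=1..N. if d dvd m then mangoldt d else 0)"
  proof (rule sum.cong[OF refl])
    fix m assume m: "m \<in> {1..n}"
    then have "d \<ge> 1 \<and> d \<le> N" if "d dvd m" for d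
      using that assms dvd_imp_le[OF that] by (auto simp: Suc_le_eq intro: Nat.gr0I)
    then have "{d. d dvd m} = {d\<in>{1..N}. d dvd m}" by auto
    then show "(\<Sum>d | d dvd m. mangoldt d) = (\<Sum>d=1..N. if d dvd m then mangoldt d else (0::real))"
      by (simp only: sum.inter_filter[OF finite_atLeastAtMost])
  qed
  also have "\<dots> = (\<Sum>d=1..N. \<Sum>m=1..n. if d dvd m then mangoldt d else 0)"
    by (rule sum.swap)
  also have "\<dots> = (\<Sum>d=1..N. mangoldt d * real (n div d))"
  proof (intro sum.cong refl)
    fix d assume d: "d \<in> {1..N}"
    have "(\<lambda>k. d * k) ` {1..n div d} = {m\<in>{1..n}. d dvd m}"
      using d by (auto simp: image_iff dvd_def Suc_le_eq less_eq_div_iff_mult_less_eq mult.commute intro: Nat.gr0I)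
    moreover have "inj_on (\<lambda>k. d * k) {1..n div d}" using d by (auto intro: inj_onI)
    ultimately have "card {m\<in>{1..n}. d dvd m} = n div d" by (metis card_image card_atLeastAtMost diff_Suc_1)
    then show "(\<Sum>m=1..n. if d dvd m then mangoldt d else (0::real)) = mangoldt d * real (n div d)"
      by (simp add: sum.If_cases Int_def)
  qed
  finally show ?thesis .
qed

lemma psi_double_le: "psi (2 * n) \<le> psi n + n * ln 4"
proof -
  have "psi (2 * n) - psi n = (\<Sum>d\<in>{n<..2*n}. mangoldt d)"
    by (rule psi_diff) simp
  also have "\<dots> \<le> (\<Sum>d\<in>{n<..2*n}. mangoldt d * (real (2 * n div d) - 2 * real (n div d)))"
  proof (intro sum_mono)
    fix d assume "d \<in> {n<..2*n}"
    then have "n div d = 0" "2 * n div d \<ge> 1" by (auto simp: div_greater_zero_iff Suc_le_eq)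
    then show "mangoldt d \<le> mangoldt d * (real (2 * n div d) - 2 * real (n div d))"
      using mangoldt_nonneg[of d] by (simp add: mult_le_cancel_left1)
  qed
  also have "\<dots> \<le> (\<Sum>d=1..2*n. mangoldt d * (real (2 * n div d) - 2 * real (n div d)))"
  proof (intro sum_mono2)
    fix d assume "d \<in> {1..2*n} - {n<..2*n}"
    have "2 * (n div d) \<le> 2 * n div d" by (metis div_mult1_eq le_add1 mult.commute)
    then have "2 * real (n div d) \<le> real (2 * n div d)" by (metis of_nat_le_iff of_nat_mult of_nat_numeral)
    then show "0 \<le> mangoldt d * (real (2 * n div d) - 2 * real (n div d))"
      using mangoldt_nonneg[of d] by simp
  qed auto
  also have "\<dots> = ln (fact (2 * n)) - 2 * ln (fact n)"
    by (subst (1 2) ln_fact_eq_sum_mangoldt[of _ "2*n"]) (auto simp: algebra_simps sum_subtractf sum_distrib_left)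
  also have "\<dots> = ln (real ((2 * n) choose n))"
    by (simp add: binomial_fact ln_div ln_mult ln_realpow flip: power2_eq_square)
  also have "\<dots> \<le> ln (4 ^ n)"
  proof -
    have "(2 * n) choose n \<le> (\<Sum>k\<le>2*n. (2*n) choose k)" by (intro member_le_sum) auto
    also have "\<dots> = 4 ^ n" by (simp add: choose_row_sum power_mult)
    finally have "real ((2 * n) choose n) \<le> 4 ^ n" by (metis of_nat_le_iff of_nat_numeral of_nat_power)
    then show ?thesis by (subst ln_le_cancel_iff) auto
  qed
  finally show ?thesis by (simp add: ln_realpow)
qed

lemma psi_le: "psi n \<le> (ln 4 + 2) * n"
proof (induction n rule: less_induct)
  case (less n)
  show ?case
  proof (cases "n = 0")
    case True
    then show ?thesis by (simp add: psi_def)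
  next
    case False
    define m where "m = n div 2"
    have IH: "psi m \<le> (ln 4 + 2) * m" using less False by (simp add: m_def)
    have e: "psi (2 * m) \<le> (ln 4 + 2) * (2 * m) - 2 * m"
      using psi_double_le[of m] IH by (simp add: algebra_simps)
    show ?thesis
    proof (cases "even n")
      case True
      then have "n = 2 * m" by (simp add: m_def)
      then show ?thesis using e by simp
    next
      case False
      then have n: "n = Suc (2 * m)" by (simp add: m_def)
      have "psi n = psi (2 * m) + mangoldt n" by (simp add: n psi_def)
      also have "mangoldt n \<le> ln (real n)" by (rule mangoldt_le) (simp add: n)
      also have "ln (real n) \<le> 2 * m" using ln_le_minus_one[of "real n"] by (simp add: n)
      finally have "psi n \<le> (ln 4 + 2) * (2 * m)" using e by simp
      also have "\<dots> \<le> (ln 4 + 2) * n" by (intro mult_left_mono) (auto simp: n add_nonneg_nonneg)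
      finally show ?thesis .
    qed
  qed
qed

lemma psi_diff_le_prime_gap:
  assumes "N \<le> M" "M \<ge> 1" and no: "\<And>p. prime p \<Longrightarrow> N < p \<Longrightarrow> p \<le> M \<Longrightarrow> False"
  shows "psi M - psi N \<le> (sqrt M + 1) * (log 2 M + 1) * ln M"
proof -
  define Q where "Q = {q\<in>{N<..M}. primepow q}"
  have "psi M - psi N = (\<Sum>q\<in>{N<..M}. mangoldt q)"
    by (rule psi_diff[OF assms(1)])
  also have "\<dots> = (\<Sum>q\<in>Q. mangoldt q)"
    by (intro sum.mono_neutral_right) (auto simp: Q_def mangoldt_def)
  also have "\<dots> \<le> (\<Sum>q\<in>Q. ln M)"
  proof (intro sum_mono)
    fix q assume "q \<in> Q"
    then have q: "q > 0" "q \<le> M" by (auto simp: Q_def)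
    have "mangoldt q \<le> ln (real q)" using q by (intro mangoldt_le)
    also have "\<dots> \<le> ln M" using q by simp
    finally show "mangoldt q \<le> ln M" .
  qed
  also have "\<dots> = card Q * ln M" by simp
  also have "\<dots> \<le> ((sqrt M + 1) * (log 2 M + 1)) * ln M"
  proof (rule mult_right_mono)
    let ?A = "{..nat \<lfloor>sqrt M\<rfloor>}" and ?B = "{..nat \<lfloor>log 2 M\<rfloor>}"
    have "Q \<subseteq> (\<lambda>(p, k). p ^ k) ` (?A \<times> ?B)"
    proof
      fix q assume q: "q \<in> Q"
      then obtain p k where p: "prime p" "k > 0" "q = p ^ k" by (auto simp: Q_def primepow_def)
      have qM: "q \<le> M" "q > N" using q by (auto simp: Q_def)
      have "k \<noteq> 1" using no[of p] p qM by auto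
      then have k2: "k \<ge> 2" using p(2) by simp
      have "p ^ 2 \<le> p ^ k" using k2 p(1) prime_gt_0_nat by (intro power_increasing) (auto simp: Suc_le_eq)
      then have "real p ^ 2 \<le> real M" using qM p(3) by (metis le_trans of_nat_le_iff of_nat_power)
      then have "real p \<le> sqrt M" by (rule real_le_rsqrt)
      then have a: "p \<in> ?A" by (simp add: le_nat_iff le_floor_iff)
      have "2 ^ k \<le> p ^ k" using prime_ge_2_nat[OF p(1)] by (intro power_mono) auto
      then have "2 ^ k \<le> M" using qM p(3) by simp
      then have "2 ^ k \<le> real M" by (metis of_nat_le_iff of_nat_numeral of_nat_power)
      then have "real k \<le> log 2 M" using le_log2_of_power[of k M] by (simp add: \<open>2 ^ k \<le> M\<close>)
      then have b: "k \<in> ?B" by (simp add: le_nat_iff le_floor_iff)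
      show "q \<in> (\<lambda>(p, k). p ^ k) ` (?A \<times> ?B)" using a b p(3) by (auto intro!: image_eqI[of _ _ "(p, k)"])
    qed
    then have "card Q \<le> card ((\<lambda>(p, k). p ^ k) ` (?A \<times> ?B))" by (intro card_mono) auto
    also have "\<dots> \<le> card (?A \<times> ?B)" by (intro card_image_le) auto
    also have "\<dots> = (nat \<lfloor>sqrt M\<rfloor> + 1) * (nat \<lfloor>log 2 M\<rfloor> + 1)" by simp
    finally have "real (card Q) \<le> real ((nat \<lfloor>sqrt M\<rfloor> + 1) * (nat \<lfloor>log 2 M\<rfloor> + 1))" by (simp only: of_nat_le_iff)
    also have "\<dots> = (real (nat \<lfloor>sqrt M\<rfloor>) + 1) * (real (nat \<lfloor>log 2 M\<rfloor>) + 1)" by (simp only: of_nat_mult of_nat_add of_nat_1)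
    also have "\<dots> \<le> (sqrt M + 1) * (log 2 M + 1)"
      using assms(2) by (intro mult_mono add_mono) auto
    finally show "real (card Q) \<le> (sqrt M + 1) * (log 2 M + 1)" .
  qed (use assms in simp)
  finally show ?thesis .
qed

text \<open>
  \<open>psi_term n z\<close> is the integral of \<open>(\<psi>(x) - x) x powr (- z - 2)\<close> over \<open>[n + 1, n + 2]\<close>, where \<open>\<psi>\<close> is constant.
\<close>

definition psi_kernel :: "nat \<Rightarrow> complex \<Rightarrow> real \<Rightarrow> complex" where
  "psi_kernel n z x = of_real (psi (Suc n) - x) * exp (- (z + 2) * of_real (ln x))"

definition psi_term :: "nat \<Rightarrow> complex \<Rightarrow> complex" where
  "psi_term n z = integral {real (Suc n)..real (Suc (Suc n))} (psi_kernel n z)"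

lemma continuous_on_psi_kernel:
  "A \<subseteq> {0<..} \<Longrightarrow> continuous_on A (psi_kernel n z)"
  unfolding psi_kernel_def[abs_def] by (intro continuous_intros) auto

lemma holomorphic_psi_term: "psi_term n holomorphic_on UNIV"
proof -
  have "(\<lambda>z. integral (cbox (real (Suc n)) (real (Suc (Suc n)))) (psi_kernel n z)) holomorphic_on UNIV"
  proof (rule leibniz_rule_holomorphic[where fx = "\<lambda>z x. - of_real (ln x) * psi_kernel n z x"])
    show "((\<lambda>z. psi_kernel n z t) has_field_derivative - of_real (ln t) * psi_kernel n z t) (at z within UNIV)" for z t
      unfolding psi_kernel_def by (auto intro!: derivative_eq_intros)
    show "psi_kernel n z integrable_on cbox (real (Suc n)) (real (Suc (Suc n)))" for z
      by (intro integrable_continuous continuous_on_psi_kernel) auto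
    show "continuous_on (UNIV \<times> cbox (real (Suc n)) (real (Suc (Suc n)))) (\<lambda>(z, t). - of_real (ln t) * psi_kernel n z t)"
      unfolding psi_kernel_def case_prod_unfold by (intro continuous_intros) auto
  qed auto
  then show ?thesis by (simp add: psi_term_def[abs_def] del: of_nat_Suc)
qed

lemma norm_psi_term_le:
  assumes "Re z \<noteq> 0"
  shows "norm (psi_term n z) \<le> (ln 4 + 3) * (real (Suc n) powr - Re z - real (Suc (Suc n)) powr - Re z) / Re z"
proof -
  let ?a = "real (Suc n)" and ?b = "real (Suc (Suc n))"
  let ?B = "ln 4 + 3 :: real"
  have ab: "?a \<le> ?b" "?a > 0" by auto
  have "((\<lambda>x. ?B * x powr (- Re z - 1)) has_integral
      (- ?B / Re z * ?b powr - Re z) - (- ?B / Re z * ?a powr - Re z)) {?a..?b}"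
  proof (rule fundamental_theorem_of_calculus[OF ab(1)])
    fix x assume "x \<in> {?a..?b}"
    then have x: "x > 0" using ab(2) by (meson atLeastAtMost_iff less_le_trans)
    have "((\<lambda>x. - ?B / Re z * x powr - Re z) has_real_derivative - ?B / Re z * (- Re z * x powr (- Re z - 1))) (at x)"
      using x by (intro DERIV_cmult has_real_derivative_powr)
    also have "- c / Re z * (- Re z * u) = c * u" for c u using assms by simp
    finally show "((\<lambda>x. - ?B / Re z * x powr - Re z) has_vector_derivative ?B * x powr (- Re z - 1)) (at x within {?a..?b})"
      by (simp only: has_real_derivative_iff_has_vector_derivative has_vector_derivative_at_within)
  qed
  moreover have "(- c / Re z * u) - (- c / Re z * v) = c * (v - u) / Re z" for c u v
    by (simp add: right_diff_distrib diff_divide_distrib)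
  ultimately have I: "((\<lambda>x. ?B * x powr (- Re z - 1)) has_integral ?B * (?a powr - Re z - ?b powr - Re z) / Re z) {?a..?b}"
    by (simp only:)
  have "norm (psi_term n z) \<le> integral {?a..?b} (\<lambda>x. ?B * x powr (- Re z - 1))"
    unfolding psi_term_def
  proof (rule integral_norm_bound_integral)
    show "psi_kernel n z integrable_on {?a..?b}"
      using ab(2) by (intro integrable_continuous_interval continuous_on_psi_kernel) auto
    show "(\<lambda>x. ?B * x powr (- Re z - 1)) integrable_on {?a..?b}" using I by (rule has_integral_integrable)
    fix x assume x: "x \<in> {?a..?b}"
    then have x0: "x > 0" using ab(2) by (meson atLeastAtMost_iff less_le_trans)
    have "psi (Suc n) \<le> (ln 4 + 2) * ?a" by (rule psi_le)
    also have "\<dots> \<le> (ln 4 + 2) * x" using x by (intro mult_left_mono) (auto simp: add_nonneg_nonneg)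
    finally have up: "psi (Suc n) - x \<le> ?B * x" using x0 by (simp add: distrib_right)
    have "1 * x \<le> ?B * x" using x0 by (intro mult_right_mono) auto
    then have "x - psi (Suc n) \<le> ?B * x" using psi_nonneg[of "Suc n"] by linarith
    with up have "\<bar>psi (Suc n) - x\<bar> \<le> ?B * x" by linarith
    then have "norm (psi_kernel n z x) \<le> (?B * x) * exp (- (Re z + 2) * ln x)"
      unfolding psi_kernel_def by (simp add: norm_mult mult_right_mono del: of_real_diff)
    also have "\<dots> = ?B * (x powr 1 * x powr - (Re z + 2))" using x0 by (simp add: powr_def mult.assoc)
    also have "x powr 1 * x powr - (Re z + 2) = x powr (- Re z - 1)"
      by (simp only: powr_add[symmetric]) (rule arg_cong, simp)
    finally show "norm (psi_kernel n z x) \<le> ?B * x powr (- Re z - 1)" .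
  qed
  then show ?thesis by (simp only: integral_unique[OF I])
qed

lemma psi_term_eq:
  fixes s :: complex
  assumes "s \<noteq> 0" "s \<noteq> 1"
  shows "psi_term n (s - 1) = psi (Suc n) / s * (of_nat (Suc n) powr - s - of_nat (Suc (Suc n)) powr - s)
     - (of_nat (Suc n) powr (1 - s) - of_nat (Suc (Suc n)) powr (1 - s)) / (s - 1)"
proof -
  let ?a = "real (Suc n)" and ?b = "real (Suc (Suc n))"
  have ab: "?a \<le> ?b" "?a > 0" by auto
  define F where "F x = - (psi (Suc n) / s) * exp (- s * of_real (ln x)) + exp ((1 - s) * of_real (ln x)) / (s - 1)" for x
  have "(psi_kernel n (s - 1) has_integral F ?b - F ?a) {?a..?b}"
  proof (rule fundamental_theorem_of_calculus[OF ab(1)])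
    fix x assume "x \<in> {?a..?b}"
    then have x: "x > 0" using ab(2) by (meson atLeastAtMost_iff less_le_trans)
    have ln: "((\<lambda>x. complex_of_real (ln x)) has_vector_derivative of_real (1 / x)) (at x within {?a..?b})"
      using x by (intro has_vector_derivative_of_real has_vector_derivative_at_within)
         (auto simp: has_real_derivative_iff_has_vector_derivative[symmetric] intro!: derivative_eq_intros)
    have d: "((\<lambda>x. exp (c * of_real (ln x))) has_vector_derivative (of_real (1 / x) * (c * exp (c * of_real (ln x))))) (at x within {?a..?b})" for c :: complex
    proof -
      have "((\<lambda>y. exp (c * y)) has_field_derivative c * exp (c * of_real (ln x))) (at (of_real (ln x)) within A)" for A
        by (rule derivative_eq_intros refl | simp)+
      from field_vector_diff_chain_within[OF ln this] show ?thesis by (simp only: o_def)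
    qed
    have "(F has_vector_derivative (- (psi (Suc n) / s) * (of_real (1 / x) * (- s * exp (- s * of_real (ln x))))
       + (of_real (1 / x) * ((1 - s) * exp ((1 - s) * of_real (ln x)))) / (s - 1))) (at x within {?a..?b})"
      unfolding F_def by (intro has_vector_derivative_add has_vector_derivative_mult_right has_vector_derivative_divide d)
    moreover have "- (psi (Suc n) / s) * (of_real (1 / x) * (- s * exp (- s * of_real (ln x))))
       + (of_real (1 / x) * ((1 - s) * exp ((1 - s) * of_real (ln x)))) / (s - 1) = psi_kernel n (s - 1) x"
    proof -
      have el: "exp (complex_of_real (ln x)) = of_real x" using x by (metis exp_ln exp_of_real)
      have e1: "exp ((1 - s) * of_real (ln x)) = of_real x * exp (- s * of_real (ln x))"
        unfolding left_diff_distrib exp_diff mult_1_left el by (simp add: exp_minus field_simps)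
      have e2: "exp (- (s - 1 + 2) * of_real (ln x)) = of_real (1 / x) * exp (- s * of_real (ln x))"
      proof -
        have "- (s - 1 + 2) * of_real (ln x) = - s * of_real (ln x) - of_real (ln x)" by (simp add: algebra_simps)
        then show ?thesis by (simp add: exp_diff el)
      qed
      have m: "(of_real (1 / x) * ((1 - s) * E)) / (s - 1) = - (of_real (1 / x) * E)" for E
      proof -
        have "c * ((1 - s) * E) = - (c * E) * (s - 1)" for c :: complex by (simp add: algebra_simps)
        then show ?thesis using assms(2) by (simp only:) simp
      qed
      have p: "- (psi (Suc n) / s) * (of_real (1 / x) * (- s * E)) = psi (Suc n) * (of_real (1 / x) * E)" for E :: complex
        using assms(1) by simp
      have "a * (c * E) + - (c * (y * E)) = (a - y) * (c * E)" for a c y E :: complex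
        by (simp add: algebra_simps)
      then show ?thesis unfolding psi_kernel_def m p e1 e2 of_real_diff .
    qed
    ultimately show "(F has_vector_derivative psi_kernel n (s - 1) x) (at x within {?a..?b})" by simp
  qed
  then have pt: "psi_term n (s - 1) = F ?b - F ?a" by (simp add: psi_term_def integral_unique)
  have E: "exp (c * of_real (ln (real (Suc k)))) = of_nat (Suc k) powr c" for c :: complex and k
    using of_nat_neq_0[of k, where ?'a = complex] by (simp add: powr_def Ln_of_nat del: of_nat_Suc)
  have FS: "F (real (Suc k)) = - (psi (Suc n) / s) * of_nat (Suc k) powr - s + of_nat (Suc k) powr (1 - s) / (s - 1)" for k
    by (simp only: F_def E)
  show ?thesis unfolding pt FS by (simp add: algebra_simps diff_divide_distrib del: of_nat_Suc)
qed

lemma sum_psi_by_parts: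
  fixes s :: complex
  shows "(\<Sum>n<N. psi (Suc n) * (of_nat (Suc n) powr - s - of_nat (Suc (Suc n)) powr - s))
   = (\<Sum>k\<le>N. mangoldt k * of_nat k powr - s) - psi N * of_nat (Suc N) powr - s"
proof (induction N)
  case 0
  then show ?case by (simp add: psi_def)
next
  case (Suc N)
  have "psi (Suc N) = psi N + mangoldt (Suc N)" by (simp add: psi_def)
  then have p: "complex_of_real (psi (Suc N)) = psi N + mangoldt (Suc N)" by simp
  show ?case using Suc.IH by (simp add: p algebra_simps del: of_nat_Suc)
qed

lemma psi_term_sums:
  assumes "Re s > 1"
  shows "(\<lambda>n. psi_term n (s - 1)) sums (mangoldt_series s / s - 1 / (s - 1))"
proof -
  have s: "s \<noteq> 0" "s \<noteq> 1" using assms by auto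
  have eq: "(\<Sum>n<N. psi_term n (s - 1)) = ((\<Sum>k\<le>N. mangoldt k * of_nat k powr - s) - psi N * of_nat (Suc N) powr - s) / s
     - (1 - of_nat (Suc N) powr (1 - s)) / (s - 1)" for N
  proof -
    have "(\<Sum>n<N. of_nat (Suc n) powr (1 - s) - of_nat (Suc (Suc n)) powr (1 - s)) = 1 - (of_nat (Suc N) powr (1 - s) :: complex)"
      by (subst sum_lessThan_telescope') simp
    moreover have "(\<Sum>n<N. psi_term n (s - 1)) = (\<Sum>n<N. psi (Suc n) * (of_nat (Suc n) powr - s - of_nat (Suc (Suc n)) powr - s)) / s
       - (\<Sum>n<N. of_nat (Suc n) powr (1 - s) - of_nat (Suc (Suc n)) powr (1 - s)) / (s - 1)"
    proof -
      have "psi_term n (s - 1) = psi (Suc n) * (of_nat (Suc n) powr - s - of_nat (Suc (Suc n)) powr - s) / s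
          - (of_nat (Suc n) powr (1 - s) - of_nat (Suc (Suc n)) powr (1 - s)) / (s - 1)" for n
        unfolding psi_term_eq[OF s] by simp
      then show ?thesis by (simp only: sum_divide_distrib sum_subtractf[symmetric])
    qed
    ultimately show ?thesis by (simp only: sum_psi_by_parts)
  qed
  have "(\<lambda>N. psi N * of_nat (Suc N) powr - s) \<longlonglongrightarrow> 0"
  proof (rule Lim_null_comparison)
    show "\<forall>\<^sub>F N in sequentially. norm (psi N * of_nat (Suc N) powr - s) \<le> (ln 4 + 2) * real N * real (Suc N) powr - Re s"
      by (intro always_eventually allI) (auto simp: norm_mult norm_of_nat_powr psi_nonneg psi_le simp del: of_nat_Suc intro!: mult_right_mono)
    show "(\<lambda>N. (ln 4 + 2) * real N * real (Suc N) powr - Re s) \<longlonglongrightarrow> 0" using assms by real_asymp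
  qed
  moreover have "(\<lambda>N. \<Sum>k\<le>N. mangoldt k * of_nat k powr - s) \<longlonglongrightarrow> mangoldt_series s"
    unfolding mangoldt_series_def by (intro summable_LIMSEQ' summable_norm_cancel[OF summable_mangoldt_series] assms)
  ultimately have "(\<lambda>N. ((\<Sum>k\<le>N. mangoldt k * of_nat k powr - s) - psi N * of_nat (Suc N) powr - s) / s
     - (1 - of_nat (Suc N) powr (1 - s)) / (s - 1)) \<longlonglongrightarrow> (mangoldt_series s - 0) / s - (1 - 0) / (s - 1)"
    using s by (intro tendsto_intros tendsto_of_nat_Suc_powr assms) auto
  then show ?thesis unfolding sums_def eq by simp
qed

lemma psi_term_0:
  "psi_term n 0 = of_real (psi (Suc n) * (1 / Suc n - 1 / Suc (Suc n)) - (ln (Suc (Suc n)) - ln (Suc n)))"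
proof -
  let ?a = "real (Suc n)" and ?b = "real (Suc (Suc n))"
  have ab: "?a \<le> ?b" "?a > 0" by auto
  have "((\<lambda>x. (psi (Suc n) - x) / x^2) has_integral (- psi (Suc n) / ?b - ln ?b) - (- psi (Suc n) / ?a - ln ?a)) {?a..?b}"
  proof (rule fundamental_theorem_of_calculus[OF ab(1)])
    fix x assume "x \<in> {?a..?b}"
    then have x: "x > 0" using ab(2) by (meson atLeastAtMost_iff less_le_trans)
    have "((\<lambda>x. - psi (Suc n) / x - ln x) has_real_derivative (psi (Suc n) - x) / x^2) (at x)"
      using x by (auto intro!: derivative_eq_intros simp: field_simps power2_eq_square)
    then show "((\<lambda>x. - psi (Suc n) / x - ln x) has_vector_derivative (psi (Suc n) - x) / x^2) (at x within {?a..?b})"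
      by (simp add: has_real_derivative_iff_has_vector_derivative has_vector_derivative_at_within)
  qed
  from has_integral_linear[OF this bounded_linear_of_real[where ?'a = complex]]
  have "((\<lambda>x. of_real ((psi (Suc n) - x) / x^2) :: complex) has_integral
     of_real ((- psi (Suc n) / ?b - ln ?b) - (- psi (Suc n) / ?a - ln ?a))) {?a..?b}"
    by (simp only: o_def)
  then have "(psi_kernel n 0 has_integral of_real ((- psi (Suc n) / ?b - ln ?b) - (- psi (Suc n) / ?a - ln ?a))) {?a..?b}"
  proof (rule has_integral_eq[rotated])
    fix x assume "x \<in> {?a..?b}"
    then have x: "x > 0" using ab(2) by (meson atLeastAtMost_iff less_le_trans)
    have "exp (- (0 + 2) * complex_of_real (ln x)) = of_real (exp (- 2 * ln x))"
    proof -
      have "- (0 + 2) * complex_of_real (ln x) = of_real (- 2 * ln x)" by simp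
      then show ?thesis by (simp only: exp_of_real)
    qed
    also have "exp (- 2 * ln x) = 1 / x^2"
    proof -
      have "exp (- 2 * ln x) = x powr - 2" using x by (simp add: powr_def)
      then show ?thesis using x by (simp add: powr_minus powr_numeral field_simps)
    qed
    finally show "of_real ((psi (Suc n) - x) / x^2) = psi_kernel n 0 x"
      unfolding psi_kernel_def by simp
  qed
  then show ?thesis by (simp add: psi_term_def integral_unique algebra_simps del: of_nat_Suc)
qed

theorem summable_psi_minus_id:
  "summable (\<lambda>n. psi (Suc n) * (1 / Suc n - 1 / Suc (Suc n)) - (ln (real (Suc (Suc n))) - ln (real (Suc n))))"
proof -
  define g where "g z = - deriv hzeta (z + 1) / ((z + 1) * hzeta (z + 1)) - 1 / (z + 1)" for z
  define H where "H = {s. Re s > 0} \<inter> hzeta -` (- {0})"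
  define U where "U = (\<lambda>z. z + 1) -` H"
  have op: "open {s. Re s > 0}" by (rule open_halfspace_Re_gt)
  have oH: "open H" unfolding H_def
    using holomorphic_on_imp_continuous_on[OF holomorphic_hzeta] op by (intro continuous_open_preimage) auto
  have U: "open U" unfolding U_def by (intro open_vimage oH continuous_intros)
  have sub: "{z. Re z \<ge> 0} \<subseteq> U" using hzeta_nonzero by (auto simp: U_def H_def)
  have hol: "(\<lambda>s. - deriv hzeta s / (s * hzeta s) - 1 / s) holomorphic_on H"
    using oH by (intro holomorphic_intros holomorphic_deriv[OF _ oH] holomorphic_on_subset[OF holomorphic_hzeta])
       (auto simp: H_def)
  have "(\<lambda>s. - deriv hzeta s / (s * hzeta s) - 1 / s) \<circ> (\<lambda>z. z + 1) holomorphic_on U"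
    by (rule holomorphic_on_compose_gen[OF _ hol]) (auto simp: U_def intro!: holomorphic_intros)
  then have g: "g holomorphic_on U" by (simp add: g_def[abs_def] o_def)
  have sums: "(\<lambda>n. psi_term n z) sums g z" if z: "Re z > 0" for z
  proof -
    let ?s = "z + 1"
    have s: "Re ?s > 1" "?s \<noteq> 0" "z \<noteq> 0" using z by (auto simp: complex_eq_iff)
    have h: "hzeta ?s \<noteq> 0" using s by (intro hzeta_nonzero) auto
    have "z * deriv hzeta ?s = hzeta ?s * (1 - z * mangoldt_series ?s)" using mangoldt_series_hzeta[OF s(1)] by simp
    then have "deriv hzeta ?s / hzeta ?s = 1 / z - mangoldt_series ?s"
      using s h by (simp add: field_simps)
    moreover have "g z = - (deriv hzeta ?s / hzeta ?s) / ?s - 1 / ?s" by (simp add: g_def mult.commute)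
    ultimately have "g z = mangoldt_series ?s / ?s - (1 / z + 1) / ?s" by (simp add: diff_divide_distrib add_divide_distrib)
    also have "1 / z + 1 = ?s / z" using s(3) by (simp add: add_divide_distrib)
    also have "mangoldt_series ?s / ?s - ?s / z / ?s = mangoldt_series ?s / ?s - 1 / z" using s(2) by simp
    finally show ?thesis using psi_term_sums[OF s(1)] by simp
  qed
  have "(\<lambda>n. psi_term n 0) sums g 0"
    by (rule Newman_tauberian[OF holomorphic_psi_term norm_psi_term_le _ U sub g sums]) (auto intro: add_nonneg_nonneg)
  then have "(\<lambda>n. Re (psi_term n 0)) sums Re (g 0)" by (rule sums_Re)
  then show ?thesis unfolding psi_term_0 by (simp add: sums_iff del: of_nat_Suc)
qed

section \<open>Primes in short intervals and density\<close>

lemma prime_in_square_gap: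
  assumes k: "k > 0"
  shows "eventually (\<lambda>j. \<exists>p. prime p \<and> k^2 * j < p \<and> p \<le> (k + 1)^2 * j) sequentially"
proof -
  define t where "t n = psi (Suc n) * (1 / Suc n - 1 / Suc (Suc n)) - (ln (real (Suc (Suc n))) - ln (real (Suc n)))" for n
  define q where "q = real k / real (k + 1)"
  define l where "l = ln (real (k + 1) / real k)"
  have q: "0 < q" "q < 1" using k by (auto simp: q_def)
  have l: "l > 0" using k by (simp add: l_def)
  define e where "e = (1 - q) * l / 4"
  have e: "e > 0" using q l by (simp add: e_def)
  have "summable t" using summable_psi_minus_id by (simp add: t_def[abs_def])
  then obtain N0 where N0: "\<And>m n. m \<ge> N0 \<Longrightarrow> norm (sum t {m..<n}) < e"
    using e unfolding summable_Cauchy by blast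
  have sum_t: "sum t {m..<n} = (\<Sum>i=m..<n. psi (Suc i) * (1 / Suc i - 1 / Suc (Suc i))) - ln (Suc n / Suc m)" if "m \<le> n" for m n
  proof -
    have "(\<Sum>i=m..<n. ln (real (Suc (Suc i))) - ln (real (Suc i))) = ln (real (Suc n) / real (Suc m))"
      using sum_Suc_diff'[OF that, of "\<lambda>i. ln (real (Suc i))"] by (simp add: ln_div del: of_nat_Suc)
    then show ?thesis unfolding t_def by (subst sum_subtractf) (simp only:)
  qed
  have tele: "(\<Sum>i=m..<n. 1 / real (Suc i) - 1 / Suc (Suc i)) = 1 / Suc m - 1 / Suc n" if "m \<le> n" for m n
    using sum_Suc_diff'[OF that, of "\<lambda>i. - 1 / real (Suc i)"] by (simp del: of_nat_Suc)
  have upper: "ln (real n / real m) - e < psi n * (1 / m - 1 / n)"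
    and lower: "psi m * (1 / m - 1 / n) < ln (real n / real m) + e"
    if m: "Suc N0 \<le> m" "m \<le> n" for m n
  proof -
    obtain m' where m': "m = Suc m'" "m' \<ge> N0" using m by (cases m) auto
    obtain n' where n': "n = Suc n'" "m' \<le> n'" using m m' by (cases n) auto
    have b: "\<bar>(\<Sum>i=m'..<n'. psi (Suc i) * (1 / Suc i - 1 / Suc (Suc i))) - ln (Suc n' / Suc m')\<bar> < e"
      using N0[OF m'(2), of n'] by (simp only: sum_t[OF n'(2)] real_norm_def)
    then have b': "\<bar>(\<Sum>i=m'..<n'. psi (Suc i) * (1 / Suc i - 1 / Suc (Suc i))) - ln (real n / real m)\<bar> < e"
      by (simp only: m'(1) n'(1))
    have pos: "1 / real (Suc i) - 1 / Suc (Suc i) \<ge> 0" for i by (simp add: field_simps)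
    have "(\<Sum>i=m'..<n'. psi (Suc i) * (1 / Suc i - 1 / Suc (Suc i))) \<le> (\<Sum>i=m'..<n'. psi n * (1 / Suc i - 1 / Suc (Suc i)))"
      by (intro sum_mono mult_right_mono psi_mono pos) (use n' in auto)
    also have "\<dots> = psi n * (1 / m - 1 / n)"
      unfolding sum_distrib_left[symmetric] tele[OF n'(2)] m'(1) n'(1) ..
    finally show "ln (real n / real m) - e < psi n * (1 / m - 1 / n)" using b' by linarith
    have "psi m * (1 / m - 1 / n) = (\<Sum>i=m'..<n'. psi m * (1 / Suc i - 1 / Suc (Suc i)))"
      unfolding sum_distrib_left[symmetric] tele[OF n'(2)] m'(1) n'(1) ..
    also have "\<dots> \<le> (\<Sum>i=m'..<n'. psi (Suc i) * (1 / Suc i - 1 / Suc (Suc i)))"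
      by (intro sum_mono mult_right_mono psi_mono pos) (use m' in auto)
    finally show "psi m * (1 / m - 1 / n) < ln (real n / real m) + e" using b' by linarith
  qed
  define c where "c = (real k + 1)^2"
  define E where "E j = (sqrt (c * real j) + 1) * (log 2 (c * real j) + 1) * ln (c * real j)" for j :: nat
  have c: "c > 0" by (simp add: c_def add_pos_nonneg)
  have kr: "real k > 0" using k by simp
  have "(\<lambda>j. E j / real j) \<longlonglongrightarrow> 0" unfolding E_def using c by real_asymp
  then have "eventually (\<lambda>j. E j / real j < e) sequentially" using e by (rule order_tendstoD)
  moreover have "eventually (\<lambda>j. j \<ge> Suc N0) sequentially" by (rule eventually_ge_at_top)
  ultimately show ?thesis
  proof eventually_elim
    case (elim j)
    have j: "j > 0" "real j > 0" using elim by auto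
    define N where "N = k^2 * j"
    define M1 where "M1 = k * (k + 1) * j"
    define M where "M = (k + 1)^2 * j"
    have "1 * j \<le> k^2 * j" using k by (intro mult_le_mono) auto
    then have jN: "j \<le> N" by (simp add: N_def)
    have NM: "N \<le> M1" "M1 \<le> M"
      unfolding N_def M1_def M_def power2_eq_square by (intro mult_le_mono; simp)+
    define K where "K = real k + 1"
    have K: "K > 0" "K - real k = 1" using kr by (simp_all add: K_def)
    have rN: "real N = real k ^ 2 * real j" "real M1 = real k * K * real j" "real M = K ^ 2 * real j"
      by (simp_all add: N_def M1_def M_def K_def algebra_simps power2_eq_square)
    have "1 / real N - 1 / real M1 = (K - real k) / (real k ^ 2 * K * real j)"
      unfolding rN using kr j K(1) by (simp add: field_simps power2_eq_square)
    then have D1: "1 / real N - 1 / real M1 = 1 / (real k ^ 2 * (real k + 1) * real j)"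
      by (simp only: K(2)) (simp only: K_def)
    have "1 / real M1 - 1 / real M = real k / K * (1 / real N - 1 / real M1)"
      unfolding rN using kr j K(1) by (simp add: field_simps power2_eq_square)
    then have D2: "1 / real M1 - 1 / real M = q * (1 / real N - 1 / real M1)"
      by (simp add: q_def K_def add.commute)
    have "real M1 / real N = K / real k" "real M / real M1 = K / real k"
      unfolding rN using kr j K(1) by (simp_all add: power2_eq_square)
    then have l1: "ln (real M1 / real N) = l" "ln (real M / real M1) = l"
      by (simp_all add: l_def K_def add.commute)
    show "\<exists>p. prime p \<and> k^2 * j < p \<and> p \<le> (k + 1)^2 * j"
    proof (rule ccontr)
      assume no: "\<nexists>p. prime p \<and> k^2 * j < p \<and> p \<le> (k + 1)^2 * j"
      define D where "D = 1 / real N - 1 / real M1"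
      have Dj: "0 \<le> D" "D \<le> 1 / real j"
      proof -
        show "0 \<le> D" unfolding D_def D1 using kr j by simp
        have "1 * 1 * real j \<le> real k ^ 2 * (real k + 1) * real j"
          using k by (intro mult_mono) (auto simp: one_le_power)
        then show "D \<le> 1 / real j" unfolding D_def D1 using j by (intro divide_left_mono) (auto intro!: mult_pos_pos kr)
      qed
      have "psi M - psi N \<le> (sqrt M + 1) * (log 2 M + 1) * ln M"
        using no NM jN j by (intro psi_diff_le_prime_gap) (auto simp: N_def M_def)
      also have "real M = c * real j" by (simp add: M_def c_def)
      finally have g: "psi M - psi N \<le> E j" by (simp add: E_def)
      have "(psi M - psi N) * D \<le> (psi M - psi N) * (1 / j)"
        using Dj psi_mono[of N M] NM by (intro mult_left_mono) auto
      also have "\<dots> \<le> E j * (1 / j)" using g by (intro mult_right_mono) auto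
      also have "\<dots> < e" using elim by simp
      finally have err: "(psi M - psi N) * D < e" .
      have "l - e < psi M * (q * D)" using upper[of M1 M] elim jN NM by (simp add: l1 D2 D_def)
      also have "\<dots> = q * (psi N * D) + q * ((psi M - psi N) * D)" by (simp add: algebra_simps)
      also have "\<dots> \<le> q * (l + e) + q * e"
        using lower[of N M1] elim jN NM err q(1) by (intro add_mono mult_left_mono) (auto simp: l1 D_def)
      also have "\<dots> \<le> q * l + 2 * e" using q e by (simp add: algebra_simps)
      finally have "(1 - q) * l < 3 * e" by (simp add: algebra_simps)
      moreover have "4 * e = (1 - q) * l" by (simp add: e_def)
      ultimately show False using e by linarith
    qed
  qed
qed

lemma prime_approx:
  assumes x: "x \<ge> 0" and e: "e > 0"
  shows "eventually (\<lambda>T. \<exists>p::nat. prime p \<and> \<bar>real p / T - x\<bar> < e) at_top"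
proof (cases "x = 0")
  case True
  show ?thesis using eventually_gt_at_top[of "max 0 (2 / e)"]
  proof eventually_elim
    case (elim T)
    then have T: "T > 0" "2 / e < T" by simp_all
    then have "2 / T < e" using e by (simp add: field_simps)
    with T(1) show ?case using True by (intro exI[of _ 2]) simp
  qed
next
  case False
  with x have x: "x > 0" by simp
  have "(\<lambda>k. x * ((real k + 1) / real k)^2) \<longlonglongrightarrow> x" using x by real_asymp
  then have "eventually (\<lambda>k. x * ((real k + 1) / real k)^2 < x + e) sequentially" using e by (intro order_tendstoD) auto
  then have "eventually (\<lambda>k. x * ((real k + 1) / real k)^2 < x + e \<and> k > 0) sequentially"
    using eventually_gt_at_top by (rule eventually_conj)
  then obtain k :: nat where k: "x * ((real k + 1) / real k)^2 < x + e" "k > 0"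
    using eventually_happens'[OF sequentially_bot] by blast
  define f where "f T = nat \<lfloor>x * T / real k ^ 2\<rfloor>" for T
  have "filterlim f at_top at_top" unfolding f_def using x k by real_asymp
  from eventually_compose_filterlim[OF prime_in_square_gap[OF k(2)] this]
  have "eventually (\<lambda>T. \<exists>p. prime p \<and> k^2 * f T < p \<and> p \<le> (k + 1)^2 * f T) at_top" .
  then show ?thesis using eventually_gt_at_top[of "max 0 (real k ^ 2 / e)"]
  proof eventually_elim
    case (elim T)
    then obtain p where p: "prime p" "k^2 * f T < p" "p \<le> (k + 1)^2 * f T" by blast
    have T': "T > 0" "real k ^ 2 / e < T" using elim(2) by simp_all
    then have T: "T > 0" "real k ^ 2 < e * T" using e by (simp_all add: field_simps)
    have k2: "real k ^ 2 > 0" using k by simp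
    have f: "real (f T) \<le> x * T / real k ^ 2" "x * T / real k ^ 2 < real (f T) + 1"
      using x T k2 unfolding f_def by auto
    have "real p \<le> (real k + 1)^2 * real (f T)" using p(3) by (metis (mono_tags) of_nat_1 of_nat_add of_nat_le_iff of_nat_mult of_nat_power)
    also have "\<dots> \<le> (real k + 1)^2 * (x * T / real k ^ 2)" using f by (intro mult_left_mono) auto
    also have "\<dots> = x * ((real k + 1) / real k)^2 * T" by (simp add: power_divide)
    also have "\<dots> < (x + e) * T" using k T by (intro mult_strict_right_mono) auto
    finally have u: "real p / T < x + e" using T by (simp add: field_simps)
    have "real k ^ 2 * real (f T) < real p" using p(2) by (metis of_nat_less_iff of_nat_mult of_nat_power)
    moreover have "x * T < real k ^ 2 * real (f T) + real k ^ 2" using f(2) k2 by (simp add: field_simps)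
    ultimately have "(x - e) * T < real p" using T by (simp add: algebra_simps)
    then have "x - e < real p / T" using T by (simp add: field_simps)
    with u p(1) show ?case by (intro exI[of _ p]) auto
  qed
qed

lemma nonneg_sphere_subset_closure_prime_directions:
  "nonneg_sphere \<subseteq> closure (direction_set {p :: nat. prime p} :: (real ^ 'k::finite) set)"
proof
  fix x :: "real ^ 'k" assume x: "x \<in> nonneg_sphere"
  then have nx: "norm x = 1" and x0: "\<And>i. x $ i \<ge> 0" by (auto simp: nonneg_sphere_def)
  show "x \<in> closure (direction_set {p :: nat. prime p})"
    unfolding closure_approachable
  proof (intro allI impI)
    fix e :: real assume e: "e > 0"
    have "isCont sgn x" using nx by (intro isCont_sgn) auto
    then obtain d where d: "d > 0" "\<And>v. dist v x < d \<Longrightarrow> dist (sgn v) (sgn x) < e"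
      using e unfolding continuous_at_eps_delta by blast
    define \<delta> where "\<delta> = d / CARD('k)"
    have \<delta>: "\<delta> > 0" using d by (simp add: \<delta>_def)
    have "eventually (\<lambda>T. \<forall>i\<in>UNIV. \<exists>p::nat. prime p \<and> \<bar>real p / T - x $ i\<bar> < \<delta>) at_top"
      by (intro eventually_ball_finite ballI prime_approx x0 \<delta>) auto
    then have "eventually (\<lambda>T. (\<forall>i\<in>UNIV. \<exists>p::nat. prime p \<and> \<bar>real p / T - x $ i\<bar> < \<delta>) \<and> T > 0) at_top"
      using eventually_gt_at_top by (rule eventually_conj)
    then obtain T :: real where T: "T > 0" "\<And>i. \<exists>p::nat. prime p \<and> \<bar>real p / T - x $ i\<bar> < \<delta>"
      using eventually_happens'[OF trivial_limit_at_top_linorder] by blast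
    then obtain p :: "'k \<Rightarrow> nat" where p: "\<And>i. prime (p i)" "\<And>i. \<bar>real (p i) / T - x $ i\<bar> < \<delta>" by metis
    define a where "a = (\<chi> i. p i)"
    have "dist (real_vec a /\<^sub>R T) x < d"
    proof -
      have "norm (real_vec a /\<^sub>R T - x) \<le> (\<Sum>i\<in>UNIV. \<bar>(real_vec a /\<^sub>R T - x) $ i\<bar>)" by (rule norm_le_l1_cart)
      also have "\<dots> < (\<Sum>i\<in>(UNIV :: 'k set). \<delta>)"
        using p(2) by (intro sum_strict_mono) (auto simp: real_vec_def a_def divide_inverse mult.commute)
      also have "\<dots> = d" by (simp add: \<delta>_def)
      finally show ?thesis by (simp add: dist_norm)
    qed
    then have "dist (sgn (real_vec a /\<^sub>R T)) (sgn x) < e" by (rule d(2))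
    moreover have "sgn x = x" using nx by (simp add: sgn_div_norm)
    moreover have "sgn (real_vec a /\<^sub>R T) = real_vec a /\<^sub>R norm (real_vec a)"
      using T by (simp add: sgn_div_norm)
    moreover have "real_vec a /\<^sub>R norm (real_vec a) \<in> direction_set {p :: nat. prime p}"
      using p(1) unfolding direction_set_def by (auto simp: a_def)
    ultimately show "\<exists>y\<in>direction_set {p :: nat. prime p}. dist y x < e" by auto
  qed
qed

theorem corollary1p6:
  assumes "CARD('k::finite) \<ge> 2"
  shows "dense_in (top_of_set (nonneg_sphere :: (real ^ 'k) set))
           (direction_set {p :: nat. prime p})"
proof -
  have sub: "direction_set {p :: nat. prime p} \<subseteq> (nonneg_sphere :: (real ^ 'k) set)"
    by (rule direction_set_subset_nonneg_sphere) (auto simp: prime_gt_0_nat)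
  have "(nonneg_sphere :: (real ^ 'k) set) \<subseteq> closure (direction_set {p :: nat. prime p})"
    by (rule nonneg_sphere_subset_closure_prime_directions)
  then show ?thesis
    using sub by (auto simp: dense_in_def closure_of_subtopology Int_absorb1)
qed

end
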